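(* Let $X_0$ be a compact metrizable space, $\mathfrak A=C(X_0)$, and let $G$ be a unimodular, amenable, second-countable locally compact group acting on $\mathfrak A$ by $\theta:G\to\mathrm{Aut}(\mathfrak A)$ so that $(\mathfrak A,G,\theta)$ is a uniquely ergodic $C^*$-dynamical system. Let $\alpha\in\mathrm{Aut}(\mathfrak A)$ commute with every $\theta_g$, let $u=(u_g)_{g\in G}$ be a continuous $1$-cocycle, and let $(\mathfrak A\rtimes_\alpha\mathbb Z,G,\Phi^u)$ be the associated skew product. Then $(\mathfrak A\rtimes_\alpha\mathbb Z,G,\Phi^u)$ is weakly ergodic if and only if for every $n\in\mathbb Z$ with $n\neq0$ the $1$-cocycle $(u_g^{(n)})_{g\in G}$ is not a continuous coboundary. In other words, it is weakly ergodic if and only if for every $n\in\mathbb Z$ with $n\ne0$ the equation in the unknown $a\in\mathfrak A$ $$\theta_g(a)u_g^{(n)}=a\quad\text{for all } g\in G$$ has only the trivial solution $a=0$.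
   Context: A $C^*$-dynamical system $(\mathfrak B,G,\beta)$ is a unital $C^*$-algebra $\mathfrak B$ with a group homomorphism $\beta:G\to\mathrm{Aut}(\mathfrak B)$ such that $g\mapsto\beta_g(b)$ is norm continuous for every $b\in\mathfrak B$. It is uniquely ergodic if there is exactly one $G$-invariant state (state $\varphi$ with $\varphi\circ\beta_g=\varphi$ for all $g$). Its fixed-point subalgebra is $\mathfrak B^G=\{b:\beta_g(b)=b\ \forall g\in G\}$; the system is weakly ergodic if $\mathfrak B^G=\mathbb C1$. A continuous $1$-cocycle is a continuous function $u:G\times X_0\to\mathbb T$ which, writing $u_g:=u(g,\cdot)\in C(X_0)$, satisfies $u_{gh}=\theta_g(u_h)u_g$ for all $g,h\in G$. It is a continuous coboundary if there is a continuous function $w:X_0\to\mathbb T$ with $u_g=\theta_g(w^* )w$ for all $g\in G$. $\mathfrak A\rtimes_\alpha\mathbb Z$ is the universal crossed product, generated by $\mathfrak A$ and a unitary $V$ with $VaV^*=\alpha(a)$ for $a\in\mathfrak A$. For $g\in G$, $\Phi^u_g$ is the automorphism of $\mathfrak A\rtimes_\alpha\mathbb Z$ with $\Phi^u_g(a)=\theta_g(a)$ for $a\in\mathfrak A$ and $\Phi^u_g(V)=u_gV$. For $n\in\mathbb Z$ the $1$-cocycle $(u_g^{(n)})_{g\in G}$ is $u_g^{(0)}=1$, $u_g^{(n)}=u_g\alpha(u_g)\cdots\alpha^{n-1}(u_g)$ for $n>0$, and $u_g^{(n)}=\alpha^{n}(u_g^* )\alpha^{n+1}(u_g^* )\cdots\alpha^{-1}(u_g^*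 )$ for $n<0$; thus $\Phi^u_g(V^n)=u_g^{(n)}V^n$. *)

theory Defs
  imports "HOL-Analysis.Analysis" "HOL-Algebra.Module"
begin

section \<open>Unital C*-algebras\<close>

class star =
  fixes star :: "'a \<Rightarrow> 'a"  (\<open>_\<^sup>\<star>\<close> [1000] 999)

class scaleC =
  fixes scaleC :: "complex \<Rightarrow> 'a \<Rightarrow> 'a"  (infixr \<open>*\<^sub>C\<close> 75)

class cstar_algebra = real_normed_algebra_1 + banach + scaleC + star +
  assumes scaleC_add_right: "a *\<^sub>C (x + y) = a *\<^sub>C x + a *\<^sub>C y"
    and scaleC_add_left: "(a + b) *\<^sub>C x = a *\<^sub>C x + b *\<^sub>C x"
    and scaleC_scaleC: "a *\<^sub>C (b *\<^sub>C x) = (a * b) *\<^sub>C x"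
    and scaleC_of_real: "complex_of_real r *\<^sub>C x = r *\<^sub>R x"
    and scaleC_mult_left: "(a *\<^sub>C x) * y = a *\<^sub>C (x * y)"
    and scaleC_mult_right: "x * (a *\<^sub>C y) = a *\<^sub>C (x * y)"
    and norm_scaleC: "norm (a *\<^sub>C x) = cmod a * norm x"
    and star_add: "(x + y)\<^sup>\<star> = x\<^sup>\<star> + y\<^sup>\<star>"
    and star_scaleC: "(a *\<^sub>C x)\<^sup>\<star> = cnj a *\<^sub>C x\<^sup>\<star>"
    and star_mult: "(x * y)\<^sup>\<star> = y\<^sup>\<star> * x\<^sup>\<star>"
    and star_star: "(x\<^sup>\<star>)\<^sup>\<star> = x"
    and cstar_identity: "norm (x\<^sup>\<star> * x) = (norm x)\<^sup>2"

lemma one_scaleC: "1 *\<^sub>C x = (x :: 'a::cstar_algebra)"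
  using scaleC_of_real[of 1 x] by simp

instantiation complex :: cstar_algebra
begin

definition star_complex :: "complex \<Rightarrow> complex" where "star_complex = cnj"

definition scaleC_complex :: "complex \<Rightarrow> complex \<Rightarrow> complex" where "scaleC_complex = (*)"

instance
  by standard
    (auto simp: star_complex_def scaleC_complex_def algebra_simps norm_mult power2_eq_square
      scaleR_conv_of_real)

end

text \<open>Bounded continuous functions with pointwise operations and the supremum norm; over a
  compact space \<open>'x\<close> the type \<open>'x \<Rightarrow>\<^sub>C complex\<close> is $C(X)$.\<close>

unbundle bcontfun.lifting

instantiation bcontfun :: (topological_space, real_normed_algebra_1) real_normed_algebra_1
begin

lift_definition times_bcontfun :: "('a \<Rightarrow>\<^sub>C 'b) \<Rightarrow> ('a \<Rightarrow>\<^sub>C 'b) \<Rightarrow> 'a \<Rightarrow>\<^sub>C 'b" is "\<lambda>f g x. f x * g x"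
proof -
  fix f g :: "'a \<Rightarrow> 'b"
  assume f: "f \<in> bcontfun" and g: "g \<in> bcontfun"
  obtain B C where "\<And>x. norm (f x) \<le> B" "\<And>x. norm (g x) \<le> C"
    using f g by (auto simp: bcontfun_def bounded_iff)
  then have "norm (f x * g x) \<le> B * C" for x
    by (smt (verit) mult_mono norm_ge_zero norm_mult_ineq)
  then show "(\<lambda>x. f x * g x) \<in> bcontfun"
    using f g by (intro bcontfun_normI) (auto simp: bcontfun_def intro!: continuous_intros)
qed

lift_definition one_bcontfun :: "'a \<Rightarrow>\<^sub>C 'b" is "\<lambda>_. 1"
  by (rule const_bcontfun)

instance
proof
  fix f g h :: "'a \<Rightarrow>\<^sub>C 'b" and r :: real
  show "f * g * h = f * (g * h)" by transfer (simp add: mult.assoc)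
  show "(f + g) * h = f * h + g * h" by transfer (simp add: distrib_right)
  show "f * (g + h) = f * g + f * h" by transfer (simp add: distrib_left)
  show "1 * f = f" by transfer simp
  show "f * 1 = f" by transfer simp
  show "(0 :: 'a \<Rightarrow>\<^sub>C 'b) \<noteq> 1" by transfer (meson zero_neq_one)
  show "r *\<^sub>R f * g = r *\<^sub>R (f * g)" by transfer simp
  show "f * r *\<^sub>R g = r *\<^sub>R (f * g)" by transfer simp
  show "norm (f * g) \<le> norm f * norm g"
  proof (rule norm_bound)
    fix x
    have "norm (f x * g x) \<le> norm (f x) * norm (g x)" by (rule norm_mult_ineq)
    also have "\<dots> \<le> norm f * norm g" by (intro mult_mono norm_bounded) auto
    finally show "norm (apply_bcontfun (f * g) x) \<le> norm f * norm g"
      by (simp add: times_bcontfun.rep_eq)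
  qed
  show "norm (1 :: 'a \<Rightarrow>\<^sub>C 'b) = 1"
  proof (rule antisym)
    show "norm (1 :: 'a \<Rightarrow>\<^sub>C 'b) \<le> 1"
      by (rule norm_bound) (simp add: one_bcontfun.rep_eq)
    show "1 \<le> norm (1 :: 'a \<Rightarrow>\<^sub>C 'b)"
      using norm_bounded[of "1 :: 'a \<Rightarrow>\<^sub>C 'b" undefined] by (simp add: one_bcontfun.rep_eq)
  qed
qed

end

instance bcontfun :: (topological_space, comm_real_normed_algebra_1) comm_ring_1
proof
  fix f g h :: "'a \<Rightarrow>\<^sub>C 'b"
  show "f * g = g * f" by transfer (simp add: mult.commute)
qed (simp_all add: algebra_simps)

instance bcontfun :: (topological_space, comm_real_normed_algebra_1) comm_real_normed_algebra_1 ..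

text \<open>The library has this instance only for metric domains.\<close>

instance bcontfun :: (topological_space, complete_space) complete_space
proof
  fix f :: "nat \<Rightarrow> ('a, 'b) bcontfun"
  assume "Cauchy f"
  then obtain g where "uniform_limit UNIV f g sequentially"
    using uniformly_convergent_eq_cauchy[of "\<lambda>_. True" f]
    unfolding Cauchy_def uniform_limit_sequentially_iff
    by (metis dist_fun_lt_imp_dist_val_lt)
  from uniform_limit_bcontfunE[OF this sequentially_bot]
  obtain l' where "g = apply_bcontfun l'" "(f \<longlonglongrightarrow> l')" by metis
  then show "convergent f"
    by (intro convergentI)
qed

instance bcontfun :: (topological_space, banach) banach ..

lemma norm_star [simp]: "norm (x\<^sup>\<star>) = norm (x :: 'b::cstar_algebra)"
proof -
  have le: "norm x \<le> norm (x\<^sup>\<star>)" for x :: 'b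
  proof (cases "x = 0")
    case False
    then show ?thesis
      using norm_mult_ineq[of "x\<^sup>\<star>" x]
      by (simp add: cstar_identity power2_eq_square)
  qed simp
  show ?thesis
    using le[of x] le[of "x\<^sup>\<star>"] by (simp add: star_star)
qed

lemma continuous_on_star [continuous_intros]:
  fixes f :: "'a::topological_space \<Rightarrow> 'b::cstar_algebra"
  assumes "continuous_on S f"
  shows "continuous_on S (\<lambda>x. (f x)\<^sup>\<star>)"
proof -
  have "(r *\<^sub>R x)\<^sup>\<star> = r *\<^sub>R x\<^sup>\<star>" for r and x :: 'b
    using star_scaleC[of "complex_of_real r" x] by (simp add: scaleC_of_real)
  then have "bounded_linear (star :: 'b \<Rightarrow> 'b)"
    by (intro bounded_linear_intro[where K = 1]) (auto simp: star_add)
  then show ?thesis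
    using assms by (rule bounded_linear.continuous_on)
qed

lemma bounded_linear_scaleC: "bounded_linear ((*\<^sub>C) a :: 'b::cstar_algebra \<Rightarrow> 'b)"
proof (rule bounded_linear_intro[where K = "cmod a"])
  fix x y :: 'b and r :: real
  show "a *\<^sub>C (x + y) = a *\<^sub>C x + a *\<^sub>C y" by (rule scaleC_add_right)
  show "a *\<^sub>C (r *\<^sub>R x) = r *\<^sub>R (a *\<^sub>C x)"
    by (metis mult.commute scaleC_of_real scaleC_scaleC)
  show "norm (a *\<^sub>C x) \<le> norm x * cmod a"
    by (simp add: norm_scaleC)
qed

instantiation bcontfun :: (topological_space, cstar_algebra) cstar_algebra
begin

lift_definition scaleC_bcontfun :: "complex \<Rightarrow> ('a \<Rightarrow>\<^sub>C 'b) \<Rightarrow> 'a \<Rightarrow>\<^sub>C 'b" is "\<lambda>a f x. a *\<^sub>C f x"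
proof -
  fix a and f :: "'a \<Rightarrow> 'b"
  assume f: "f \<in> bcontfun"
  then obtain B where B: "\<And>x. norm (f x) \<le> B"
    by (auto simp: bcontfun_def bounded_iff)
  show "(\<lambda>x. a *\<^sub>C f x) \<in> bcontfun"
  proof (rule bcontfun_normI)
    show "continuous_on UNIV (\<lambda>x. a *\<^sub>C f x)"
      using f by (auto simp: bcontfun_def intro: bounded_linear.continuous_on[OF bounded_linear_scaleC])
    show "norm (a *\<^sub>C f x) \<le> cmod a * B" for x
      using B[of x] by (simp add: norm_scaleC mult_left_mono)
  qed
qed

lift_definition star_bcontfun :: "('a \<Rightarrow>\<^sub>C 'b) \<Rightarrow> 'a \<Rightarrow>\<^sub>C 'b" is "\<lambda>f x. (f x)\<^sup>\<star>"
  by (auto simp: bcontfun_def bounded_iff intro!: continuous_intros)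

instance
proof
  fix f g :: "'a \<Rightarrow>\<^sub>C 'b" and a b :: complex and r :: real
  show "a *\<^sub>C (f + g) = a *\<^sub>C f + a *\<^sub>C g" by transfer (simp add: scaleC_add_right)
  show "(a + b) *\<^sub>C f = a *\<^sub>C f + b *\<^sub>C f" by transfer (simp add: scaleC_add_left)
  show "a *\<^sub>C b *\<^sub>C f = (a * b) *\<^sub>C f" by transfer (simp add: scaleC_scaleC)
  show "complex_of_real r *\<^sub>C f = r *\<^sub>R f" by transfer (simp add: scaleC_of_real)
  show "(a *\<^sub>C f) * g = a *\<^sub>C (f * g)" by transfer (simp add: scaleC_mult_left)
  show "f * (a *\<^sub>C g) = a *\<^sub>C (f * g)" by transfer (simp add: scaleC_mult_right)
  show "(f + g)\<^sup>\<star> = f\<^sup>\<star> + g\<^sup>\<star>" by transfer (simp add: star_add)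
  show "(a *\<^sub>C f)\<^sup>\<star> = cnj a *\<^sub>C f\<^sup>\<star>" by transfer (simp add: star_scaleC)
  show "(f * g)\<^sup>\<star> = g\<^sup>\<star> * f\<^sup>\<star>" by transfer (simp add: star_mult)
  show "(f\<^sup>\<star>)\<^sup>\<star> = f" by transfer (simp add: star_star)
  have le: "norm (c *\<^sub>C h) \<le> cmod c * norm h" for c and h :: "'a \<Rightarrow>\<^sub>C 'b"
    by (rule norm_bound) (simp add: scaleC_bcontfun.rep_eq norm_scaleC mult_left_mono norm_bounded)
  have id: "c *\<^sub>C d *\<^sub>C h = (c * d) *\<^sub>C h" "1 *\<^sub>C h = h" for c d and h :: "'a \<Rightarrow>\<^sub>C 'b"
    subgoal by transfer (simp add: scaleC_scaleC)
    subgoal by transfer (simp add: one_scaleC)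
    done
  show "norm (a *\<^sub>C f) = cmod a * norm f"
  proof (cases "a = 0")
    case True
    then show ?thesis using le[of a f] by simp
  next
    case False
    have "norm f \<le> cmod (inverse a) * norm (a *\<^sub>C f)"
      using le[of "inverse a" "a *\<^sub>C f"] False by (simp add: id)
    then have "cmod a * norm f \<le> norm (a *\<^sub>C f)"
      using False by (simp add: norm_divide field_simps)
    then show ?thesis using le[of a f] by simp
  qed
  show "norm (f\<^sup>\<star> * f) = (norm f)\<^sup>2"
  proof (rule antisym)
    show "norm (f\<^sup>\<star> * f) \<le> (norm f)\<^sup>2"
      by (rule norm_bound)
        (simp add: star_bcontfun.rep_eq times_bcontfun.rep_eq cstar_identity power_mono norm_bounded)
    have "norm f \<le> sqrt (norm (f\<^sup>\<star> * f))"
    proof (rule norm_bound)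
      fix x
      have "(norm (f x))\<^sup>2 \<le> norm (f\<^sup>\<star> * f)"
        using norm_bounded[of "f\<^sup>\<star> * f" x]
        by (simp add: star_bcontfun.rep_eq times_bcontfun.rep_eq cstar_identity)
      then show "norm (f x) \<le> sqrt (norm (f\<^sup>\<star> * f))"
        by (rule real_le_rsqrt)
    qed
    then show "(norm f)\<^sup>2 \<le> norm (f\<^sup>\<star> * f)"
      by (metis norm_ge_zero power_mono real_sqrt_pow2)
  qed
qed

end

lifting_update bcontfun.lifting
lifting_forget bcontfun.lifting

lemmas [simp] =
  times_bcontfun.rep_eq one_bcontfun.rep_eq scaleC_bcontfun.rep_eq star_bcontfun.rep_eq

definition star_hom :: "('a::cstar_algebra \<Rightarrow> 'b::cstar_algebra) \<Rightarrow> bool" where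
  "star_hom f \<longleftrightarrow>
     (\<forall>x y. f (x + y) = f x + f y) \<and> (\<forall>c x. f (c *\<^sub>C x) = c *\<^sub>C f x) \<and>
     (\<forall>x y. f (x * y) = f x * f y) \<and> (\<forall>x. f (x\<^sup>\<star>) = (f x)\<^sup>\<star>) \<and> f 1 = 1"

definition star_automorphism :: "('a::cstar_algebra \<Rightarrow> 'a) \<Rightarrow> bool" where
  "star_automorphism f \<longleftrightarrow> star_hom f \<and> bij f"

definition unitary :: "'a::cstar_algebra \<Rightarrow> bool" where
  "unitary v \<longleftrightarrow> v\<^sup>\<star> * v = 1 \<and> v * v\<^sup>\<star> = 1"

definition state :: "('a::cstar_algebra \<Rightarrow> complex) \<Rightarrow> bool" where
  "state \<phi> \<longleftrightarrow>
     (\<forall>x y. \<phi> (x + y) = \<phi> x + \<phi> y) \<and> (\<forall>c x. \<phi> (c *\<^sub>C x) = c * \<phi> x) \<and>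
     (\<forall>x. \<phi> (x\<^sup>\<star> * x) \<in> \<real>\<^sub>\<ge>\<^sub>0) \<and> \<phi> 1 = 1"

definition cstar_generates :: "'a::cstar_algebra set \<Rightarrow> bool" where
  "cstar_generates S \<longleftrightarrow>
     (\<forall>T. S \<subseteq> T \<and> 1 \<in> T \<and> (\<forall>x\<in>T. \<forall>y\<in>T. x + y \<in> T) \<and> (\<forall>c. \<forall>x\<in>T. c *\<^sub>C x \<in> T) \<and>
        (\<forall>x\<in>T. \<forall>y\<in>T. x * y \<in> T) \<and> (\<forall>x\<in>T. x\<^sup>\<star> \<in> T) \<and> closed T \<longrightarrow> T = UNIV)"


section \<open>Unimodular and amenable groups\<close>

text \<open>Groups are written additively but are not assumed to be commutative. On a second countable
  locally compact Hausdorff space a Borel measure that is finite on compact sets is automatically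
  regular.\<close>

definition left_haar_measure :: "'g::topological_group_add measure \<Rightarrow> bool" where
  "left_haar_measure \<mu> \<longleftrightarrow>
     sets \<mu> = sets borel \<and> (\<forall>K. compact K \<longrightarrow> emeasure \<mu> K < \<infinity>) \<and>
     (\<forall>U. open U \<and> U \<noteq> {} \<longrightarrow> emeasure \<mu> U > 0) \<and>
     (\<forall>g. \<forall>S\<in>sets borel. emeasure \<mu> ((\<lambda>x. g + x) ` S) = emeasure \<mu> S)"

definition unimodular_group :: "'g::topological_group_add itself \<Rightarrow> bool" where
  "unimodular_group _ \<longleftrightarrow>
     (\<exists>\<mu> :: 'g measure. left_haar_measure \<mu> \<and>
        (\<forall>g. \<forall>S\<in>sets borel. emeasure \<mu> ((\<lambda>x. x + g) ` S) = emeasure \<mu> S))"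

text \<open>A left invariant mean on $L^\infty(G)$. Every class in $L^\infty(G)$ has a bounded Borel
  representative, so the mean is given as a functional on bounded Borel functions that does not
  see null sets; its values outside that space are irrelevant.\<close>

definition left_invariant_mean :: "'g::topological_group_add measure \<Rightarrow> (('g \<Rightarrow> real) \<Rightarrow> real) \<Rightarrow> bool" where
  "left_invariant_mean \<mu> m \<longleftrightarrow>
     (let L = {f. f \<in> borel_measurable borel \<and> bounded (range f)} in
       (\<forall>f\<in>L. \<forall>h\<in>L. (AE x in \<mu>. f x = h x) \<longrightarrow> m f = m h) \<and>
       (\<forall>f\<in>L. \<forall>h\<in>L. m (\<lambda>x. f x + h x) = m f + m h) \<and>
       (\<forall>c. \<forall>f\<in>L. m (\<lambda>x. c * f x) = c * m f) \<and>
       (\<forall>f\<in>L. (\<forall>x. 0 \<le> f x) \<longrightarrow> 0 \<le> m f) \<and>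
       m (\<lambda>_. 1) = 1 \<and>
       (\<forall>g. \<forall>f\<in>L. m (\<lambda>x. f (g + x)) = m f))"

definition amenable_group :: "'g::topological_group_add itself \<Rightarrow> bool" where
  "amenable_group _ \<longleftrightarrow> (\<exists>\<mu> :: 'g measure. left_haar_measure \<mu> \<and> (\<exists>m. left_invariant_mean \<mu> m))"


section \<open>C*-dynamical systems\<close>

definition cstar_dynamical_system :: "('g::topological_group_add \<Rightarrow> 'b::cstar_algebra \<Rightarrow> 'b) \<Rightarrow> bool" where
  "cstar_dynamical_system \<beta> \<longleftrightarrow>
     (\<forall>g. star_automorphism (\<beta> g)) \<and> (\<forall>g h. \<beta> (g + h) = \<beta> g \<circ> \<beta> h) \<and>
     (\<forall>b. continuous_on UNIV (\<lambda>g. \<beta> g b))"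

definition uniquely_ergodic :: "('g \<Rightarrow> 'b::cstar_algebra \<Rightarrow> 'b) \<Rightarrow> bool" where
  "uniquely_ergodic \<beta> \<longleftrightarrow> (\<exists>!\<phi>. state \<phi> \<and> (\<forall>g. \<phi> \<circ> \<beta> g = \<phi>))"

definition fixed_point_subalgebra :: "('g \<Rightarrow> 'b \<Rightarrow> 'b) \<Rightarrow> 'b set" where
  "fixed_point_subalgebra \<beta> = {b. \<forall>g. \<beta> g b = b}"

definition weakly_ergodic :: "('g \<Rightarrow> 'b::cstar_algebra \<Rightarrow> 'b) \<Rightarrow> bool" where
  "weakly_ergodic \<beta> \<longleftrightarrow> fixed_point_subalgebra \<beta> = range (\<lambda>c. c *\<^sub>C 1)"


section \<open>Universal crossed products by the integers\<close>

text \<open>HOL cannot quantify over types inside a formula, so the universal property below ranges over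
  all C*-algebras whose carrier is a subset of a given type, presented as records.\<close>

record 'd cstar_record = "(complex, 'd) module" +
  adj :: "'d \<Rightarrow> 'd"
  nrm :: "'d \<Rightarrow> real"

definition complex_field :: "complex ring" where
  "complex_field = \<lparr>carrier = UNIV, monoid.mult = (*), one = 1, ring.zero = 0, add = (+)\<rparr>"

definition cstar_algebra_on :: "'d cstar_record \<Rightarrow> bool" where
  "cstar_algebra_on D \<longleftrightarrow>
     Module.module complex_field D \<and> Ring.ring D \<and>
     (\<forall>c. \<forall>x\<in>carrier D. \<forall>y\<in>carrier D.
        (c \<odot>\<^bsub>D\<^esub> x) \<otimes>\<^bsub>D\<^esub> y = c \<odot>\<^bsub>D\<^esub> (x \<otimes>\<^bsub>D\<^esub> y) \<and> x \<otimes>\<^bsub>D\<^esub> (c \<odot>\<^bsub>D\<^esub> y) = c \<odot>\<^bsub>D\<^esub> (x \<otimes>\<^bsub>D\<^esub> y)) \<and>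
     adj D \<in> carrier D \<rightarrow> carrier D \<and>
     (\<forall>x\<in>carrier D. adj D (adj D x) = x) \<and>
     (\<forall>c. \<forall>x\<in>carrier D. adj D (c \<odot>\<^bsub>D\<^esub> x) = cnj c \<odot>\<^bsub>D\<^esub> adj D x) \<and>
     (\<forall>x\<in>carrier D. \<forall>y\<in>carrier D.
        adj D (x \<oplus>\<^bsub>D\<^esub> y) = adj D x \<oplus>\<^bsub>D\<^esub> adj D y \<and> adj D (x \<otimes>\<^bsub>D\<^esub> y) = adj D y \<otimes>\<^bsub>D\<^esub> adj D x) \<and>
     (\<forall>x\<in>carrier D. 0 \<le> nrm D x \<and> (nrm D x = 0 \<longleftrightarrow> x = \<zero>\<^bsub>D\<^esub>)) \<and>
     (\<forall>c. \<forall>x\<in>carrier D. nrm D (c \<odot>\<^bsub>D\<^esub> x) = cmod c * nrm D x) \<and>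
     (\<forall>x\<in>carrier D. \<forall>y\<in>carrier D.
        nrm D (x \<oplus>\<^bsub>D\<^esub> y) \<le> nrm D x + nrm D y \<and> nrm D (x \<otimes>\<^bsub>D\<^esub> y) \<le> nrm D x * nrm D y) \<and>
     (\<forall>x\<in>carrier D. nrm D (adj D x \<otimes>\<^bsub>D\<^esub> x) = (nrm D x)\<^sup>2) \<and>
     Metric_space.mcomplete (carrier D) (\<lambda>x y. nrm D (x \<ominus>\<^bsub>D\<^esub> y))"

definition star_hom_into :: "'d cstar_record \<Rightarrow> ('a::cstar_algebra \<Rightarrow> 'd) \<Rightarrow> bool" where
  "star_hom_into D f \<longleftrightarrow>
     range f \<subseteq> carrier D \<and>
     (\<forall>x y. f (x + y) = f x \<oplus>\<^bsub>D\<^esub> f y) \<and> (\<forall>c x. f (c *\<^sub>C x) = c \<odot>\<^bsub>D\<^esub> f x) \<and>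
     (\<forall>x y. f (x * y) = f x \<otimes>\<^bsub>D\<^esub> f y) \<and> (\<forall>x. f (x\<^sup>\<star>) = adj D (f x)) \<and> f 1 = \<one>\<^bsub>D\<^esub>"

definition covariant_pair_into ::
  "('a::cstar_algebra \<Rightarrow> 'a) \<Rightarrow> 'd cstar_record \<Rightarrow> ('a \<Rightarrow> 'd) \<Rightarrow> 'd \<Rightarrow> bool" where
  "covariant_pair_into \<alpha> D \<pi> U \<longleftrightarrow>
     star_hom_into D \<pi> \<and>
     U \<in> carrier D \<and> adj D U \<otimes>\<^bsub>D\<^esub> U = \<one>\<^bsub>D\<^esub> \<and> U \<otimes>\<^bsub>D\<^esub> adj D U = \<one>\<^bsub>D\<^esub> \<and>
     (\<forall>a. U \<otimes>\<^bsub>D\<^esub> \<pi> a \<otimes>\<^bsub>D\<^esub> adj D U = \<pi> (\<alpha> a))"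

definition record_of_type :: "'b::cstar_algebra cstar_record" where
  "record_of_type = \<lparr>carrier = UNIV, monoid.mult = (*), one = 1, ring.zero = 0, add = (+),
     smult = (*\<^sub>C), adj = star, nrm = norm\<rparr>"

text \<open>\<open>universal_crossed_product \<alpha> \<iota> V\<close>: the algebra \<open>'b\<close>, with embedding \<open>\<iota>\<close> of \<open>'a\<close> and unitary
  \<open>V\<close>, is the universal crossed product of \<open>'a\<close> by \<open>\<alpha>\<close>. Testing universality on
  C*-algebras carried by subsets of \<open>'b\<close> loses nothing for separable \<open>'a\<close>: the range of a covariant
  pair generates a separable C*-algebra, which has at most continuum many elements, and \<open>'b\<close> has
  at least that many. The factorizing homomorphism is unique because \<open>'b\<close> is generated by
  \<open>range \<iota>\<close> and \<open>V\<close>.\<close>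

definition universal_crossed_product ::
  "('a::cstar_algebra \<Rightarrow> 'a) \<Rightarrow> ('a \<Rightarrow> 'b::cstar_algebra) \<Rightarrow> 'b \<Rightarrow> bool" where
  "universal_crossed_product \<alpha> \<iota> V \<longleftrightarrow>
     star_hom \<iota> \<and> inj \<iota> \<and> unitary V \<and> (\<forall>a. V * \<iota> a * V\<^sup>\<star> = \<iota> (\<alpha> a)) \<and>
     cstar_generates (insert V (range \<iota>)) \<and>
     (\<forall>(D :: 'b cstar_record) \<pi> U. cstar_algebra_on D \<and> covariant_pair_into \<alpha> D \<pi> U \<longrightarrow>
        (\<exists>\<rho>. star_hom_into D \<rho> \<and> \<rho> \<circ> \<iota> = \<pi> \<and> \<rho> V = U))"

lemma cring_complex_field: "cring complex_field"
  by (rule cringI, rule abelian_groupI)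
    (auto simp: complex_field_def algebra_simps intro!: comm_monoidI exI[of _ "- _"])

lemma a_minus_record_of_type: "x \<ominus>\<^bsub>record_of_type\<^esub> y = x - (y :: 'b::cstar_algebra)"
  and cstar_algebra_on_record_of_type: "cstar_algebra_on (record_of_type :: 'b cstar_record)"
proof -
  let ?D = "record_of_type :: 'b cstar_record"
  have ag: "abelian_group ?D"
    by (rule abelian_groupI)
      (auto simp: record_of_type_def algebra_simps intro: exI[of _ "- _"])
  have ring: "Ring.ring ?D"
    by (rule ringI[OF ag])
      (auto simp: record_of_type_def algebra_simps intro!: monoidI)
  have mod: "Module.module complex_field ?D"
    by (rule moduleI[OF cring_complex_field ag])
      (auto simp: record_of_type_def complex_field_def scaleC_add_left scaleC_add_right
        scaleC_scaleC one_scaleC)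
  have "\<ominus>\<^bsub>?D\<^esub> y = - y" for y
    by (rule abelian_group.minus_equality[OF ag]) (auto simp: record_of_type_def)
  then show minus: "x \<ominus>\<^bsub>?D\<^esub> y = x - y" for x y
    by (simp add: a_minus_def) (simp add: record_of_type_def)
  have "Metric_space.mcomplete (UNIV :: 'b set) dist"
    using complete_UNIV mcomplete_iff_complete by auto
  then have "Metric_space.mcomplete (carrier ?D) (\<lambda>x y. nrm ?D (x \<ominus>\<^bsub>?D\<^esub> y))"
    unfolding minus by (simp add: record_of_type_def dist_norm[abs_def])
  then show "cstar_algebra_on ?D"
    unfolding cstar_algebra_on_def using ring mod
    by (auto simp: record_of_type_def scaleC_mult_left scaleC_mult_right star_add star_scaleC
        star_mult star_star norm_scaleC cstar_identity norm_triangle_ineq norm_mult_ineq)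
qed

lemma star_hom_into_record_of_type: "star_hom_into record_of_type f \<longleftrightarrow> star_hom f"
  by (simp add: star_hom_into_def star_hom_def record_of_type_def)

lemma covariant_pair_into_record_of_type:
  "covariant_pair_into \<alpha> record_of_type \<pi> U \<longleftrightarrow>
     star_hom \<pi> \<and> unitary U \<and> (\<forall>a. U * \<pi> a * U\<^sup>\<star> = \<pi> (\<alpha> a))"
  by (simp add: covariant_pair_into_def star_hom_into_record_of_type unitary_def)
    (simp add: record_of_type_def)


section \<open>Cocycles and skew products\<close>

definition continuous_cocycle ::
  "('g::topological_group_add \<Rightarrow> ('x::topological_space \<Rightarrow>\<^sub>C complex) \<Rightarrow> ('x \<Rightarrow>\<^sub>C complex)) \<Rightarrow>
   ('g \<Rightarrow> ('x \<Rightarrow>\<^sub>C complex)) \<Rightarrow> bool" where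
  "continuous_cocycle \<theta> u \<longleftrightarrow>
     continuous_on UNIV (\<lambda>(g, x). apply_bcontfun (u g) x) \<and>
     (\<forall>g x. cmod (apply_bcontfun (u g) x) = 1) \<and>
     (\<forall>g h. u (g + h) = \<theta> g (u h) * u g)"

definition continuous_coboundary ::
  "('g \<Rightarrow> ('x::topological_space \<Rightarrow>\<^sub>C complex) \<Rightarrow> ('x \<Rightarrow>\<^sub>C complex)) \<Rightarrow> ('g \<Rightarrow> ('x \<Rightarrow>\<^sub>C complex)) \<Rightarrow> bool" where
  "continuous_coboundary \<theta> u \<longleftrightarrow>
     (\<exists>w. (\<forall>x. cmod (apply_bcontfun w x) = 1) \<and> (\<forall>g. u g = \<theta> g (w\<^sup>\<star>) * w))"

definition fun_powi :: "('a \<Rightarrow> 'a) \<Rightarrow> int \<Rightarrow> 'a \<Rightarrow> 'a" where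
  "fun_powi \<alpha> k = (if k \<ge> 0 then \<alpha> ^^ nat k else (inv_into UNIV \<alpha>) ^^ nat (- k))"

definition iterated_cocycle ::
  "(('x::topological_space \<Rightarrow>\<^sub>C complex) \<Rightarrow> ('x \<Rightarrow>\<^sub>C complex)) \<Rightarrow> ('g \<Rightarrow> ('x \<Rightarrow>\<^sub>C complex)) \<Rightarrow>
   int \<Rightarrow> 'g \<Rightarrow> ('x \<Rightarrow>\<^sub>C complex)" where
  "iterated_cocycle \<alpha> u n g =
     (if n \<ge> 0 then \<Prod>k\<in>{0..<n}. fun_powi \<alpha> k (u g)
      else \<Prod>k\<in>{n..<0}. fun_powi \<alpha> k ((u g)\<^sup>\<star>))"

definition skew_product_action ::
  "('g \<Rightarrow> 'a \<Rightarrow> 'a) \<Rightarrow> ('g \<Rightarrow> 'a) \<Rightarrow> ('a \<Rightarrow> 'b) \<Rightarrow> 'b \<Rightarrow> 'g \<Rightarrow> 'b::cstar_algebra \<Rightarrow> 'b" where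
  "skew_product_action \<theta> u \<iota> V g =
     (THE \<Phi>. star_automorphism \<Phi> \<and> (\<forall>a. \<Phi> (\<iota> a) = \<iota> (\<theta> g a)) \<and> \<Phi> V = \<iota> (u g) * V)"

end

theory Submission
  imports Defs
begin

text \<open>The dual action of the circle on the crossed product multiplies \<open>V\<close> by a scalar of modulus 1 and
  commutes with the skew product. Hence the Fourier components of a fixed element are fixed, and the
  component of degree \<open>n\<close> has the form \<open>\<iota> a * V\<^sup>n\<close> with \<open>\<theta>\<^sub>g(a) u\<^sub>g\<^sup>(\<^sup>n\<^sup>) = a\<close>; by Fejer summation an
  element all of whose components of nonzero degree vanish lies in \<open>range \<iota>\<close>. Conversely a nonzero
  solution \<open>a\<close> makes \<open>\<iota> a * V\<^sup>n\<close> a fixed element, which is not scalar because it has degree \<open>n\<close>.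
  If \<open>a\<close> is a solution, then \<open>\<bar>a\<bar>\<^sup>2\<close> is fixed by \<open>\<theta>\<close>, hence constant by amenability and unique
  ergodicity, and \<open>a / \<bar>a\<bar>\<close> exhibits the cocycle as a coboundary.\<close>

section \<open>Homomorphisms of C*-algebras\<close>

lemma scaleC_minus_one: "(-1) *\<^sub>C x = - (x :: 'a::cstar_algebra)"
  using scaleC_of_real[of "-1" x] by simp

lemma scaleC_diff_right: "c *\<^sub>C (x - y) = c *\<^sub>C x - c *\<^sub>C (y :: 'a::cstar_algebra)"
  using scaleC_add_right[of c "x - y" y] by simp

lemma star_zero [simp]: "(0 :: 'a::cstar_algebra)\<^sup>\<star> = 0"
  using star_add[of "0::'a" 0] by simp

lemma star_one [simp]: "(1 :: 'a::cstar_algebra)\<^sup>\<star> = 1"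
  using star_mult[of "(1::'a)\<^sup>\<star>" 1] by (simp add: star_star)

lemma star_minus: "(- x)\<^sup>\<star> = - ((x :: 'a::cstar_algebra)\<^sup>\<star>)"
  using star_scaleC[of "-1" x] by (simp add: scaleC_minus_one)

lemma star_diff: "(x - y)\<^sup>\<star> = x\<^sup>\<star> - (y :: 'a::cstar_algebra)\<^sup>\<star>"
  using star_add[of x "- y"] by (simp add: star_minus)

lemma star_scaleR: "(r *\<^sub>R x)\<^sup>\<star> = r *\<^sub>R (x :: 'a::cstar_algebra)\<^sup>\<star>"
  using star_scaleC[of "complex_of_real r" x] by (simp add: scaleC_of_real)

lemma unitary_norm: "unitary v \<Longrightarrow> norm (v :: 'a::cstar_algebra) = 1"
  using cstar_identity[of v] norm_ge_zero[of v] by (auto simp: unitary_def power2_eq_1_iff simp del: norm_ge_zero)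

lemma unitary_mult: "unitary v \<Longrightarrow> unitary w \<Longrightarrow> unitary (v * w :: 'a::cstar_algebra)"
  unfolding unitary_def by (metis (no_types, lifting) mult.assoc mult_1_right star_mult)

lemma unitary_scaleC:
  assumes "unitary (v :: 'a::cstar_algebra)" "cmod z = 1"
  shows "unitary (z *\<^sub>C v)"
proof -
  have "z * cnj z = 1" using assms(2) by (simp add: complex_norm_square[symmetric])
  then show ?thesis
    using assms(1)
    by (simp add: unitary_def star_scaleC scaleC_mult_left scaleC_mult_right scaleC_scaleC
      mult.commute[of "cnj z"] one_scaleC)
qed

lemma star_homD:
  assumes "star_hom f"
  shows star_hom_add: "f (x + y) = f x + f y"
    and star_hom_scaleC: "f (c *\<^sub>C x) = c *\<^sub>C f x"
    and star_hom_mult: "f (x * y) = f x * f y"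
    and star_hom_star: "f (x\<^sup>\<star>) = (f x)\<^sup>\<star>"
    and star_hom_one: "f 1 = 1"
  using assms by (auto simp: star_hom_def)

lemma star_hom_scaleR: "star_hom f \<Longrightarrow> f (r *\<^sub>R x) = r *\<^sub>R f x"
  using star_hom_scaleC[of f "complex_of_real r" x] by (simp add: scaleC_of_real)

lemma star_hom_zero: "star_hom f \<Longrightarrow> f 0 = 0"
  using star_hom_add[of f 0 0] by simp

lemma star_hom_unitary: "star_hom f \<Longrightarrow> unitary v \<Longrightarrow> unitary (f v)"
  unfolding unitary_def by (metis star_hom_mult star_hom_one star_hom_star)

lemma star_hom_comp: "star_hom f \<Longrightarrow> star_hom h \<Longrightarrow> star_hom (f \<circ> h)"
  by (simp add: star_hom_def)

lemma star_hom_id: "star_hom id"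
  by (simp add: star_hom_def)

text \<open>The fixed point equation \<open>y = (a\<^sup>2 + y\<^sup>2) / 2\<close> says that \<open>b = 1 - y\<close> satisfies
  \<open>a\<^sup>2 + b\<^sup>2 = 1\<close>.\<close>

lemma selfadjoint_circle:
  fixes a :: "'a::cstar_algebra"
  assumes sa: "a\<^sup>\<star> = a" and na: "norm a < 1"
  obtains b where "b\<^sup>\<star> = b" "a * b = b * a" "a * a + b * b = 1"
proof -
  \<comment> \<open>The bound \<open>norm a\<close> serves twice: it is the radius of a ball that
    \<open>f\<close> maps into itself, and it is the Lipschitz constant of \<open>f\<close> there.
    Self-adjointness and commutation with \<open>a\<close> are closed conditions, so the fixed point
    inherits them.\<close>
  define S where "S = {y. y\<^sup>\<star> = y \<and> a * y = y * a \<and> norm y \<le> norm a}"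
  define f where "f = (\<lambda>y. (1/2) *\<^sub>R (a * a + y * y))"
  have "closed S"
    unfolding S_def by (intro closed_Collect_conj closed_Collect_eq closed_Collect_le continuous_intros)
  then have 1: "complete S" by (simp add: complete_eq_closed)
  have 2: "S \<noteq> {}" by (auto simp: S_def intro: exI[of _ 0])
  have "f y \<in> S" if "y \<in> S" for y
  proof -
    have c: "a * y = y * a" and s: "y\<^sup>\<star> = y" and n: "norm y \<le> norm a" using that by (auto simp: S_def)
    have c2: "a * (y * y) = y * y * a" by (metis c mult.assoc)
    have "norm (a * a + y * y) \<le> norm a * norm a + norm a * norm a"
      by (intro norm_triangle_le add_mono order_trans[OF norm_mult_ineq] mult_mono n) auto
    also have "\<dots> \<le> 2 * norm a"
      using mult_left_le[of "norm a" "norm a"] na by simp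
    finally have "norm (f y) \<le> norm a" by (simp add: f_def)
    moreover have "a * f y = f y * a" using c2 by (simp add: f_def algebra_simps)
    ultimately show ?thesis
      by (simp add: S_def) (simp add: f_def star_scaleR star_add star_mult s sa)
  qed
  then have 3: "f ` S \<subseteq> S" by auto
  have 4: "dist (f y) (f z) \<le> norm a * dist y z" if "y \<in> S" "z \<in> S" for y z
  proof -
    have ny: "norm y \<le> norm a" and nz: "norm z \<le> norm a" using that by (auto simp: S_def)
    \<comment> \<open>This factorisation of the difference of squares holds even when
      \<open>y\<close> and \<open>z\<close> do not commute.\<close>
    have "f y - f z = (1/2) *\<^sub>R (y * (y - z) + (y - z) * z)"
      by (simp add: f_def algebra_simps)
    then have "norm (f y - f z) = (1/2) * norm (y * (y - z) + (y - z) * z)" by simp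
    also have "\<dots> \<le> (1/2) * (norm a * norm (y - z) + norm (y - z) * norm a)"
      by (intro mult_left_mono norm_triangle_le add_mono order_trans[OF norm_mult_ineq] mult_mono ny nz)
        auto
    finally show ?thesis by (simp add: dist_norm)
  qed
  obtain y where y: "y \<in> S" "f y = y"
    using Banach_fix[OF 1 2 _ na 3] 4 by auto
  have yy: "y * y = 2 *\<^sub>R y - a * a"
    using arg_cong[OF y(2), of "\<lambda>v. 2 *\<^sub>R v"] by (simp add: f_def algebra_simps)
  show ?thesis
  proof (rule that[of "1 - y"])
    show "(1 - y)\<^sup>\<star> = 1 - y" "a * (1 - y) = (1 - y) * a"
      using y(1) by (simp_all add: S_def star_diff algebra_simps)
    show "a * a + (1 - y) * (1 - y) = 1"
      using yy by (simp add: algebra_simps scaleR_2)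
  qed
qed

text \<open>A self-adjoint element of norm less than 1 is the real part of a unitary, and homomorphisms
  preserve unitaries; no spectral theory is needed.\<close>

lemma star_hom_selfadjoint_norm_le_one:
  assumes f: "star_hom f" and sa: "a\<^sup>\<star> = a" and na: "norm a < 1"
  shows "norm (f a) \<le> 1"
proof -
  obtain b where b: "b\<^sup>\<star> = b" "a * b = b * a" "a * a + b * b = 1"
    using selfadjoint_circle[OF sa na] .
  define v where "v = a + \<i> *\<^sub>C b"
  have vs: "v\<^sup>\<star> = a - \<i> *\<^sub>C b"
    using scaleC_scaleC[of "-1" \<i> b]
    by (simp add: v_def star_add star_scaleC sa b scaleC_minus_one)
  have ii: "\<i> *\<^sub>C \<i> *\<^sub>C x = - x" for x :: 'a
    by (simp add: scaleC_scaleC scaleC_minus_one)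
  have v: "unitary v"
    unfolding unitary_def vs
    using b by (simp add: v_def distrib_left distrib_right left_diff_distrib right_diff_distrib
        scaleC_mult_left scaleC_mult_right scaleC_add_right scaleC_diff_right ii)
  have "2 *\<^sub>R a = v + v\<^sup>\<star>"
    by (simp add: vs) (simp add: v_def scaleR_2)
  then have "2 *\<^sub>R f a = f v + (f v)\<^sup>\<star>"
    by (metis f star_hom_add star_hom_scaleR star_hom_star)
  then have "2 * norm (f a) = norm (f v + (f v)\<^sup>\<star>)"
    by (metis abs_numeral norm_scaleR)
  also have "\<dots> \<le> 1 + 1"
    using unitary_norm[OF star_hom_unitary[OF f v]] norm_triangle_ineq[of "f v" "(f v)\<^sup>\<star>"] by simp
  finally show ?thesis by simp
qed

text \<open>By the C*-identity it suffices to treat the self-adjoint element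
  \<open>x\<^sup>\<star> * x\<close>. A self-adjoint \<open>a\<close> is divided by
  \<open>norm a + e\<close>, which puts it strictly inside the unit ball even when
  \<open>a = 0\<close>.\<close>

lemma star_hom_norm_le:
  assumes f: "star_hom f"
  shows "norm (f x) \<le> norm x"
proof -
  have sa: "norm (f a) \<le> norm a" if a: "a\<^sup>\<star> = a" for a
  proof (rule field_le_epsilon)
    fix e :: real assume e: "e > 0"
    define r where "r = norm a + e"
    have r: "r > 0" using e by (simp add: r_def add_nonneg_pos)
    have "norm (f ((1/r) *\<^sub>R a)) \<le> 1"
      using r e by (intro star_hom_selfadjoint_norm_le_one f) (auto simp: star_scaleR a r_def)
    then show "norm (f a) \<le> norm a + e"
      using r by (simp add: star_hom_scaleR[OF f] r_def[symmetric] divide_simps)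
  qed
  have "(norm (f x))\<^sup>2 = norm (f (x\<^sup>\<star> * x))"
    by (simp add: star_homD[OF f] cstar_identity)
  also have "\<dots> \<le> norm (x\<^sup>\<star> * x)" by (rule sa) (simp add: star_mult star_star)
  finally have "(norm (f x))\<^sup>2 \<le> (norm x)\<^sup>2" by (simp add: cstar_identity)
  then show ?thesis by (rule power2_le_imp_le) simp
qed

lemma star_hom_bounded_linear: "star_hom f \<Longrightarrow> bounded_linear f"
  by (intro bounded_linear_intro[where K = 1])
    (auto simp: star_hom_add star_hom_scaleR star_hom_norm_le)

text \<open>Homomorphisms are contractive, so the set where two of them agree is a closed
  subalgebra, stable under adjoints, and it contains the generators.\<close>

lemma star_hom_eqI:
  fixes f h :: "'a::cstar_algebra \<Rightarrow> 'b::cstar_algebra"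
  assumes gen: "cstar_generates S" and f: "star_hom f" and h: "star_hom h"
    and eq: "\<And>x. x \<in> S \<Longrightarrow> f x = h x"
  shows "f = h"
proof -
  have "continuous_on UNIV f" "continuous_on UNIV h"
    using f h by (auto intro!: linear_continuous_on star_hom_bounded_linear)
  then have "closed {x. f x = h x}" by (intro closed_Collect_eq)
  then have "{x. f x = h x} = UNIV"
    using gen[unfolded cstar_generates_def, rule_format, of "{x. f x = h x}"] eq
    by (auto simp: star_homD[OF f] star_homD[OF h])
  then show ?thesis by auto
qed

lemma star_automorphism_fun_powi:
  assumes "star_automorphism \<alpha>"
  shows "star_hom (fun_powi \<alpha> n)"
proof -
  have a: "star_hom \<alpha>" "bij \<alpha>" using assms by (auto simp: star_automorphism_def)
  have pow: "star_hom (f ^^ k)" if "star_hom f" for f :: "'a \<Rightarrow> 'a" and k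
    using that by (induction k) (auto simp: star_hom_def)
  define b where "b = inv_into UNIV \<alpha>"
  have ab: "\<alpha> (b x) = x" and ba: "b (\<alpha> x) = x" for x
    using a(2) by (auto simp: b_def bij_is_inj bij_is_surj surj_f_inv_f inv_f_f)
  have "star_hom b"
    unfolding star_hom_def by (metis ab ba star_homD[OF a(1)])
  then show ?thesis using a(1) by (auto simp: fun_powi_def b_def intro!: pow)
qed

lemma fun_powi_0 [simp]: "fun_powi \<alpha> 0 x = x"
  by (simp add: fun_powi_def)

section \<open>Integer powers of a unitary\<close>

text \<open>The adjoint stands in for the inverse, so the exponent laws below assume
  \<open>V\<close> unitary.\<close>

definition upow :: "'b::cstar_algebra \<Rightarrow> int \<Rightarrow> 'b" where
  "upow V n = (if n \<ge> 0 then V ^ nat n else (V\<^sup>\<star>) ^ nat (- n))"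

lemma upow_0 [simp]: "upow V 0 = 1"
  by (simp add: upow_def)

lemma upow_succ:
  assumes "unitary V"
  shows "upow V (n + 1) = upow V n * V"
proof (cases "n \<ge> 0")
  case True
  then show ?thesis by (simp add: upow_def nat_add_distrib power_commutes)
next
  case False
  \<comment> \<open>Writing \<open>n = - (k + 1)\<close> makes \<open>n + 1 = - k\<close>: one
    factor \<open>V\<close> cancels one adjoint. The value \<open>k = 0\<close> lands in the
    nonnegative branch of \<open>upow\<close>, whence the final case split.\<close>
  then obtain k where k: "n = - int (Suc k)" by (metis int_cases not_le zero_le_imp_eq_int of_nat_0_le_iff)
  have "nat (- n) = Suc k" "nat (- (n + 1)) = k" using k by auto
  moreover have "(V\<^sup>\<star>) ^ Suc k * V = (V\<^sup>\<star>) ^ k"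
    using assms by (simp add: unitary_def mult.assoc power_Suc2 del: power_Suc)
  ultimately show ?thesis using False k by (cases k) (auto simp: upow_def)
qed

lemma upow_pred: "unitary V \<Longrightarrow> upow V (n - 1) = upow V n * V\<^sup>\<star>"
  using upow_succ[of V "n - 1"] by (simp add: unitary_def mult.assoc)

lemma upow_add:
  assumes "unitary V"
  shows "upow V (m + n) = upow V m * upow V n"
proof (induction n rule: int_induct[where k = 0])
  case (step1 i)
  then show ?case using upow_succ[OF assms, of "m + i"] by (simp add: upow_succ assms add.assoc mult.assoc)
next
  case (step2 i)
  then show ?case using upow_pred[OF assms, of "m + i"] by (simp add: upow_pred assms add_diff_eq mult.assoc)
qed simp

lemma unitary_upow:
  assumes "unitary (V :: 'a::cstar_algebra)"
  shows "unitary (upow V n)"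
proof -
  have 1: "unitary (1 :: 'a)" by (simp add: unitary_def)
  have 2: "unitary (V\<^sup>\<star>)" using assms by (simp add: unitary_def star_star)
  have 3: "unitary (W ^ k)" if "unitary W" for W :: 'a and k
    by (induction k) (auto simp: 1 that unitary_mult)
  show ?thesis using assms 2 3 by (auto simp: upow_def)
qed

lemma star_upow:
  assumes "unitary (V :: 'a::cstar_algebra)"
  shows "(upow V n)\<^sup>\<star> = upow V (- n)"
proof -
  have "upow V n * upow V (- n) = 1" using upow_add[OF assms, of n "-n"] by simp
  then show ?thesis
    using unitary_upow[OF assms, of n] unfolding unitary_def by (metis mult.assoc mult_1_left mult_1_right)
qed

section \<open>The gauge action on the crossed product\<close>

lemma bounded_linear_scaleC_left: "bounded_linear (\<lambda>c. c *\<^sub>C (x :: 'a::cstar_algebra))"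
proof (rule bounded_linear_intro[where K = "norm x"])
  show "(r *\<^sub>R c) *\<^sub>C x = r *\<^sub>R (c *\<^sub>C x)" for r c
    using scaleC_of_real[of r "c *\<^sub>C x"] by (simp add: scaleR_conv_of_real scaleC_scaleC)
qed (auto simp: scaleC_add_left norm_scaleC)

lemma scaleC_zero_left [simp]: "0 *\<^sub>C (x :: 'a::cstar_algebra) = 0"
  using scaleC_of_real[of 0 x] by simp

lemma scaleC_scaleR: "c *\<^sub>C r *\<^sub>R x = r *\<^sub>R c *\<^sub>C (x :: 'a::cstar_algebra)"
  by (simp flip: scaleC_of_real add: scaleC_scaleC mult.commute)

lemma continuous_on_scaleC [continuous_intros]:
  fixes f :: "'t::topological_space \<Rightarrow> complex" and h :: "'t \<Rightarrow> 'a::cstar_algebra"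
  assumes "continuous_on S f" "continuous_on S h"
  shows "continuous_on S (\<lambda>t. f t *\<^sub>C h t)"
proof -
  have "f t *\<^sub>C h t = (f t *\<^sub>C 1) * h t" for t by (simp add: scaleC_mult_left)
  then show ?thesis
    using assms
    by (auto intro!: continuous_intros bounded_linear.continuous_on[OF bounded_linear_scaleC_left])
qed

text \<open>Orthogonality of the characters of the circle: for nonzero \<open>k\<close> the
  antiderivative \<open>F\<close> has period 1, so it takes equal values at both end points.\<close>

lemma has_integral_cis:
  "((\<lambda>t. cis (2 * pi * of_int k * t)) has_integral (if k = 0 then 1 else 0)) {0..1}"
proof (cases "k = 0")
  case True
  then show ?thesis using has_integral_const_real[of "1::complex" 0 1] by simp
next
  case False
  define F where "F = (\<lambda>t. cis (2 * pi * of_int k * t) / (2 * pi * of_int k * \<i>))"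
  have "((\<lambda>t. cis (2 * pi * of_int k * t)) has_integral F 1 - F 0) {0..1}"
  proof (rule fundamental_theorem_of_calculus)
    fix t :: real
    define c where "c = 2 * pi * of_int k * \<i>"
    have c: "c \<noteq> 0" using False by (simp add: c_def)
    have cis: "cis (2 * pi * of_int k * s) = exp (c * complex_of_real s)" for s
      by (simp add: cis_conv_exp c_def mult_ac)
    have "((\<lambda>z. exp (c * z) / c) has_field_derivative exp (c * complex_of_real t)) (at (complex_of_real t))"
      using c by (auto intro!: derivative_eq_intros)
    from has_vector_derivative_real_field[OF this]
    show "(F has_vector_derivative cis (2 * pi * of_int k * t)) (at t within {0..1})"
      unfolding F_def cis unfolding c_def .
  qed simp
  moreover have "F 1 = F 0"
    using cis_multiple_2pi[of "of_int k"] by (simp add: F_def)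
  ultimately show ?thesis using False by simp
qed

section \<open>Covariance and universality of the crossed product\<close>

locale crossed_product =
  fixes \<alpha> :: "'a::cstar_algebra \<Rightarrow> 'a" and \<iota> :: "'a \<Rightarrow> 'b::cstar_algebra" and V :: 'b
  assumes automorphism: "star_automorphism \<alpha>"
    and universal: "universal_crossed_product \<alpha> \<iota> V"
begin

lemma embedding: "star_hom \<iota>" "inj \<iota>"
  and unitary_V: "unitary V"
  and generates: "cstar_generates (insert V (range \<iota>))"
  using universal by (auto simp: universal_crossed_product_def)

lemmas embedding_simps = star_homD[OF embedding(1)]

lemma V_embedding: "V * \<iota> a = \<iota> (\<alpha> a) * V"
proof -
  have "\<iota> (\<alpha> a) = V * \<iota> a * V\<^sup>\<star>" using universal by (simp add: universal_crossed_product_def)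
  then show ?thesis using unitary_V by (simp add: unitary_def mult.assoc)
qed

text \<open>Universality is applied with the crossed product itself as target, viewed as a record,
  so that it produces endomorphisms. Covariance is stated without the adjoint, the form in which it
  is checked later.\<close>

lemma covariant_extension:
  assumes "star_hom \<pi>" "unitary U" "\<And>a. U * \<pi> a = \<pi> (\<alpha> a) * (U :: 'b)"
  obtains \<rho> where "star_hom \<rho>" "\<And>a. \<rho> (\<iota> a) = \<pi> a" "\<rho> V = U"
proof -
  have "covariant_pair_into \<alpha> record_of_type \<pi> U"
    using assms by (simp add: covariant_pair_into_record_of_type unitary_def mult.assoc)
  then have "\<exists>\<rho>. star_hom_into record_of_type \<rho> \<and> \<rho> \<circ> \<iota> = \<pi> \<and> \<rho> V = U"
    using universal cstar_algebra_on_record_of_type unfolding universal_crossed_product_def by blast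
  then show ?thesis
    using that by (metis comp_apply star_hom_into_record_of_type)
qed

lemma hom_eqI:
  assumes "star_hom f" "star_hom h" "\<And>a. f (\<iota> a) = h (\<iota> a)" "f V = h V"
  shows "f = h"
  using assms by (intro star_hom_eqI[OF generates]) auto

text \<open>The rule that sorts words: powers of \<open>V\<close> move to the right and twist the
  coefficient. The induction is over all \<open>a\<close>, since passing one more \<open>V\<close>
  or its adjoint replaces \<open>a\<close> by its image or preimage under
  \<open>\<alpha>\<close>.\<close>

lemma upow_embedding: "upow V n * \<iota> a = \<iota> (fun_powi \<alpha> n a) * upow V n"
proof (induction n arbitrary: a rule: int_induct[where k = 0])
  case base
  then show ?case by simp
next
  case (step1 i)
  have "fun_powi \<alpha> i (\<alpha> a) = fun_powi \<alpha> (i + 1) a"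
    using step1(1) by (simp add: fun_powi_def nat_add_distrib funpow_swap1)
  then show ?case
    using step1(2)[of "\<alpha> a"]
    by (simp add: upow_succ unitary_V mult.assoc V_embedding) (simp flip: mult.assoc)
next
  case (step2 i)
  have bij: "bij \<alpha>" using automorphism by (simp add: star_automorphism_def)
  define b where "b = inv_into UNIV \<alpha> a"
  have ab: "\<alpha> b = a" using bij by (simp add: b_def bij_is_surj surj_f_inv_f)
  have "fun_powi \<alpha> i b = fun_powi \<alpha> (i - 1) a"
  proof -
    have "nat (- (i - 1)) = Suc (nat (- i))" using step2(1) by simp
    then show ?thesis using step2(1) ab bij
      by (auto simp: fun_powi_def b_def funpow_swap1 bij_is_inj)
  qed
  moreover have "V\<^sup>\<star> * \<iota> a = \<iota> b * V\<^sup>\<star>"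
  proof -
    have "V\<^sup>\<star> * \<iota> a * V = \<iota> b"
      using V_embedding[of b] unitary_V ab by (metis mult.assoc mult_1_left unitary_def)
    then show ?thesis
      using unitary_V by (metis mult.assoc mult_1_right unitary_def)
  qed
  ultimately show ?case
    using step2(2)[of b]
    by (simp add: upow_pred unitary_V mult.assoc) (simp flip: mult.assoc)
qed

section \<open>Twisted Laurent polynomials\<close>

text \<open>Scalars are absorbed by the coefficient, so closure under addition is enough to obtain a
  linear span.\<close>

inductive_set laurent :: "'b set" where
  monomial: "\<iota> a * upow V n \<in> laurent"
| add: "x \<in> laurent \<Longrightarrow> y \<in> laurent \<Longrightarrow> x + y \<in> laurent"

lemma monomial_mult:
  "(\<iota> a * upow V m) * (\<iota> b * upow V n) = \<iota> (a * fun_powi \<alpha> m b) * upow V (m + n)"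
  by (metis (no_types, lifting) embedding_simps(3) mult.assoc unitary_V upow_add upow_embedding)

lemma laurent_mult: "x \<in> laurent \<Longrightarrow> y \<in> laurent \<Longrightarrow> x * y \<in> laurent"
proof (induction x rule: laurent.induct)
  case (monomial a m)
  from monomial.prems show ?case
    by (induction y rule: laurent.induct)
      (auto simp: monomial_mult distrib_left intro: laurent.intros)
qed (auto simp: distrib_right intro: laurent.intros)

lemma laurent_scaleC: "x \<in> laurent \<Longrightarrow> c *\<^sub>C x \<in> laurent"
proof (induction x rule: laurent.induct)
  case (monomial a n)
  then show ?case
    using laurent.monomial[of "c *\<^sub>C a" n] by (simp add: embedding_simps scaleC_mult_left)
qed (auto simp: scaleC_add_right intro: laurent.intros)

text \<open>Taking adjoints puts the power of \<open>V\<close> on the left;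
  \<open>upow_embedding\<close> brings it back to the right.\<close>

lemma laurent_star: "x \<in> laurent \<Longrightarrow> x\<^sup>\<star> \<in> laurent"
proof (induction x rule: laurent.induct)
  case (monomial a n)
  have "(\<iota> a * upow V n)\<^sup>\<star> = \<iota> (fun_powi \<alpha> (- n) (a\<^sup>\<star>)) * upow V (- n)"
    by (simp add: star_mult star_upow unitary_V flip: embedding_simps upow_embedding)
  then show ?case by (simp add: laurent.monomial)
qed (auto simp: star_add intro: laurent.intros)

text \<open>The generators lie in \<open>laurent\<close>, so it is enough that its closure is a
  subalgebra stable under adjoints.\<close>

lemma laurent_dense: "closure laurent = UNIV"
proof -
  have c: "y \<in> laurent \<Longrightarrow> y \<in> closure laurent" for y
    using closure_subset by blast
  have img: "f x \<in> closure laurent"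
    if "continuous_on UNIV f" "\<And>y. y \<in> laurent \<Longrightarrow> f y \<in> closure laurent" "x \<in> closure laurent" for f x
    using image_closure_subset[of laurent f "closure laurent"] that
      continuous_on_subset[OF that(1), of "closure laurent"] by auto
  \<comment> \<open>Sums and products are extended one argument at a time: first the right one, with
    the left one in \<open>laurent\<close>, then the left one.\<close>
  have add1: "x + y \<in> closure laurent" if "x \<in> laurent" "y \<in> closure laurent" for x y
    by (rule img[of "\<lambda>y. x + y", OF _ _ that(2)]) (auto intro!: continuous_intros c laurent.add that(1))
  have mult1: "x * y \<in> closure laurent" if "x \<in> laurent" "y \<in> closure laurent" for x y
    by (rule img[of "\<lambda>y. x * y", OF _ _ that(2)]) (auto intro!: continuous_intros c laurent_mult that(1))
  have add: "x + y \<in> closure laurent" if "x \<in> closure laurent" "y \<in> closure laurent" for x y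
    by (rule img[of "\<lambda>x. x + y", OF _ _ that(1)]) (auto intro!: continuous_intros add1 that(2))
  have mult: "x * y \<in> closure laurent" if "x \<in> closure laurent" "y \<in> closure laurent" for x y
    by (rule img[of "\<lambda>x. x * y", OF _ _ that(1)]) (auto intro!: continuous_intros mult1 that(2))
  have scale: "k *\<^sub>C x \<in> closure laurent" if "x \<in> closure laurent" for k x
    by (rule img[of "\<lambda>x. k *\<^sub>C x", OF _ _ that]) (auto intro!: continuous_intros c laurent_scaleC)
  have star: "x\<^sup>\<star> \<in> closure laurent" if "x \<in> closure laurent" for x
    by (rule img[of star, OF _ _ that]) (auto intro!: continuous_intros c laurent_star)
  have \<iota>: "\<iota> a \<in> laurent" for a using laurent.monomial[of a 0] by simp
  have V: "V \<in> laurent" using laurent.monomial[of 1 1] by (simp add: embedding_simps upow_def)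
  have one: "1 \<in> laurent" using \<iota>[of 1] by (simp add: embedding_simps)
  show ?thesis
    by (rule generates[unfolded cstar_generates_def, THEN spec, THEN mp],
        intro conjI insert_subsetI image_subsetI ballI allI closed_closure c[OF \<iota>] c[OF V] c[OF one]
          add mult scale star; assumption)
qed

lemma laurent_approx:
  assumes "e > 0"
  obtains p where "p \<in> laurent" "norm (b - p) < e"
  using laurent_dense assms closure_approachable[of b laurent]
  by (auto simp: dist_norm norm_minus_commute)

section \<open>The dual action of the circle\<close>

text \<open>The circle is parametrised by real \<open>t\<close> with period 1. The values on
  \<open>range \<iota>\<close> and at \<open>V\<close> determine the homomorphism, by
  \<open>hom_eqI\<close>.\<close>

definition gauge :: "real \<Rightarrow> 'b \<Rightarrow> 'b" where
  "gauge t = (SOME \<rho>. star_hom \<rho> \<and> (\<forall>a. \<rho> (\<iota> a) = \<iota> a) \<and> \<rho> V = cis (2 * pi * t) *\<^sub>C V)"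

text \<open>A scalar of modulus 1 commutes with everything, so rescaling \<open>V\<close> by it
  keeps the pair covariant and universality applies.\<close>

lemma
  shows gauge_hom: "star_hom (gauge t)"
    and gauge_embedding: "gauge t (\<iota> a) = \<iota> a"
    and gauge_V: "gauge t V = cis (2 * pi * t) *\<^sub>C V"
proof -
  obtain \<rho> where "star_hom \<rho> \<and> (\<forall>a. \<rho> (\<iota> a) = \<iota> a) \<and> \<rho> V = cis (2 * pi * t) *\<^sub>C V"
    by (rule covariant_extension[of \<iota> "cis (2 * pi * t) *\<^sub>C V"])
      (auto simp: embedding unitary_V unitary_scaleC scaleC_mult_left scaleC_mult_right V_embedding)
  from someI[of "\<lambda>\<rho>. star_hom \<rho> \<and> (\<forall>a. \<rho> (\<iota> a) = \<iota> a) \<and> \<rho> V = cis (2 * pi * t) *\<^sub>C V", OF this]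
  show "star_hom (gauge t)" "gauge t (\<iota> a) = \<iota> a" "gauge t V = cis (2 * pi * t) *\<^sub>C V"
    unfolding gauge_def by blast+
qed

lemmas gauge_simps = star_homD[OF gauge_hom]

lemma gauge_upow: "gauge t (upow V n) = cis (2 * pi * of_int n * t) *\<^sub>C upow V n"
proof (induction n rule: int_induct[where k = 0])
  case base
  then show ?case by (simp add: gauge_simps one_scaleC)
next
  case (step1 i)
  have "cis (2 * pi * of_int (i + 1) * t) = cis (2 * pi * of_int i * t) * cis (2 * pi * t)"
    by (simp add: cis_mult algebra_simps)
  with step1 show ?case
    unfolding upow_succ[OF unitary_V]
    by (simp add: gauge_simps gauge_V scaleC_mult_left scaleC_mult_right scaleC_scaleC mult.commute)
next
  case (step2 i)
  then show ?case
    by (simp add: upow_pred unitary_V gauge_simps gauge_V star_scaleC cis_cnj scaleC_mult_left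
        scaleC_mult_right scaleC_scaleC cis_mult left_diff_distrib right_diff_distrib)
qed

lemma gauge_monomial:
  "gauge t (\<iota> a * upow V n) = cis (2 * pi * of_int n * t) *\<^sub>C (\<iota> a * upow V n)"
  by (simp add: gauge_simps gauge_embedding gauge_upow scaleC_mult_right)

text \<open>Orbits of Laurent polynomials are trigonometric polynomials in \<open>t\<close>. Since
  every \<open>gauge t\<close> is contractive, norm convergence of elements makes their orbits
  converge uniformly in \<open>t\<close>, so continuity survives limits.\<close>

lemma continuous_gauge: "continuous_on S (\<lambda>t. gauge t b)"
proof -
  let ?C = "{b. continuous_on UNIV (\<lambda>t. gauge t b)}"
  have "x \<in> ?C" if "x \<in> laurent" for x
    using that
    by induction (auto simp: gauge_monomial gauge_simps(1) intro!: continuous_intros)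
  moreover have "closed ?C"
    unfolding closed_sequential_limits
  proof safe
    fix x l assume x: "\<forall>n. x n \<in> ?C" "x \<longlonglongrightarrow> l"
    have "uniform_limit UNIV (\<lambda>n t. gauge t (x n)) (\<lambda>t. gauge t l) sequentially"
    proof (rule uniform_limitI)
      fix e :: real assume "e > 0"
      then have "\<forall>\<^sub>F n in sequentially. dist (x n) l < e" using x(2) by (rule tendstoD[rotated])
      moreover have "dist (gauge t (x n)) (gauge t l) \<le> dist (x n) l" for t n
        using star_hom_norm_le[OF gauge_hom, of t "x n - l"]
        by (simp add: dist_norm linear_diff bounded_linear.linear star_hom_bounded_linear gauge_hom)
      ultimately show "\<forall>\<^sub>F n in sequentially. \<forall>t\<in>UNIV. dist (gauge t (x n)) (gauge t l) < e"
        by (auto elim!: eventually_mono intro: le_less_trans)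
    qed
    then show "continuous_on UNIV (\<lambda>t. gauge t l)"
      by (rule uniform_limit_theorem[rotated]) (use x(1) in auto)
  qed
  ultimately have "closure laurent \<subseteq> ?C" by (intro closure_minimal) auto
  then show ?thesis using laurent_dense continuous_on_subset by blast
qed

section \<open>Fourier components\<close>

text \<open>The Fourier coefficient of the orbit map \<open>t \<mapsto> gauge t b\<close>; the
  frequency \<open>- n\<close> cancels the eigenvalue of the gauge action in degree
  \<open>n\<close>.\<close>

definition component :: "int \<Rightarrow> 'b \<Rightarrow> 'b" where
  "component n b = integral {0..1} (\<lambda>t. cis (2 * pi * of_int (- n) * t) *\<^sub>C gauge t b)"

lemma component_has_integral:
  "((\<lambda>t. cis (2 * pi * of_int (- n) * t) *\<^sub>C gauge t b) has_integral component n b) {0..1}"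
  unfolding component_def
  by (intro integrable_integral integrable_continuous_real continuous_intros continuous_gauge)

lemma component_monomial:
  "component n (\<iota> a * upow V m) = (if m = n then \<iota> a * upow V m else 0)"
proof -
  let ?x = "\<iota> a * upow V m"
  have eq: "cis (2 * pi * of_int (- n) * t) *\<^sub>C gauge t ?x = cis (2 * pi * of_int (m - n) * t) *\<^sub>C ?x" for t
    by (simp add: gauge_monomial scaleC_scaleC cis_mult algebra_simps)
  have "((\<lambda>t. cis (2 * pi * of_int (m - n) * t) *\<^sub>C ?x) has_integral (if m = n then ?x else 0)) {0..1}"
    using has_integral_linear[OF has_integral_cis[of "m - n"] bounded_linear_scaleC_left[of ?x]]
    by (cases "m = n") (simp_all add: o_def one_scaleC)
  then show ?thesis
    using component_has_integral[of n ?x] has_integral_unique unfolding eq by blast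
qed

text \<open>A bounded linear map passes under the integral; complex homogeneity takes it past the
  character, and the last assumption past the gauge action.\<close>

lemma component_commute:
  assumes f: "bounded_linear f" "\<And>c x. f (c *\<^sub>C x) = c *\<^sub>C f x" "\<And>t. f (gauge t b) = gauge t (f b)"
  shows "f (component n b) = component n (f b)"
  using has_integral_linear[OF component_has_integral[of n b] f(1)]
    component_has_integral[of n "f b"]
  by (auto simp: o_def f(2,3) dest: has_integral_unique)

lemma bounded_linear_component: "bounded_linear (component n)"
proof (rule bounded_linear_intro[where K = 1])
  show "component n (x + y) = component n x + component n y" for x y
    using has_integral_add[OF component_has_integral[of n x] component_has_integral[of n y]]
      component_has_integral[of n "x + y"]
    by (auto simp: gauge_simps scaleC_add_right dest: has_integral_unique)
  show "component n (r *\<^sub>R x) = r *\<^sub>R component n x" for r x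
    by (rule component_commute[symmetric])
      (simp_all add: bounded_linear_scaleR_right star_hom_scaleR[OF gauge_hom] scaleC_scaleR)
  show "norm (component n x) \<le> norm x * 1" for x
    using integral_bound[of 0 1 "\<lambda>t. cis (2 * pi * of_int (- n) * t) *\<^sub>C gauge t x" "norm x"]
    unfolding component_def
    by (simp add: norm_scaleC star_hom_norm_le gauge_hom continuous_intros continuous_gauge)
qed

text \<open>Stripping off the power of \<open>V\<close> leaves a coefficient for every Laurent
  polynomial, and a continuous map that sends a dense set into a closed set sends everything
  there.\<close>

lemma component_in_range:
  assumes "closed (range \<iota>)"
  shows "\<exists>a. component n b = \<iota> a * upow V n"
proof -
  have V: "upow V n * upow V (- n) = 1" "upow V (- n) * upow V n = 1"
    by (simp_all flip: upow_add add: unitary_V)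
  define C where "C = {b. component n b * upow V (- n) \<in> range \<iota>}"
  have "continuous_on UNIV (\<lambda>b. component n b * upow V (- n))"
    by (intro continuous_intros linear_continuous_on bounded_linear_component)
  from closed_vimage[OF assms this] have "closed C" by (simp add: C_def vimage_def)
  moreover have "laurent \<subseteq> C"
  proof
    show "x \<in> C" if "x \<in> laurent" for x
      using that
    proof induction
      case (monomial a m)
      have "component n (\<iota> a * upow V m) * upow V (- n) = \<iota> (if m = n then a else 0)"
        by (simp add: component_monomial mult.assoc V star_hom_zero embedding)
      then show ?case unfolding C_def by blast
    next
      case (add x y)
      then obtain a b where "component n x * upow V (- n) = \<iota> a" "component n y * upow V (- n) = \<iota> b"
        by (auto simp: C_def)
      then have "component n (x + y) * upow V (- n) = \<iota> (a + b)"
        by (simp add: embedding_simps distrib_right linear_add bounded_linear.linear bounded_linear_component)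
      then show ?case unfolding C_def by blast
    qed
  qed
  ultimately have "C = UNIV" using laurent_dense closure_minimal by blast
  then obtain a where "component n b * upow V (- n) = \<iota> a" by (auto simp: C_def)
  then have "component n b = \<iota> a * upow V n" by (metis V(2) mult.assoc mult_1_right)
  then show ?thesis ..
qed

section \<open>Fejer summation\<close>

text \<open>The Fejer mean: the difference \<open>j - i\<close> takes a value \<open>k\<close> with
  \<open>\<bar>k\<bar> < N\<close> exactly \<open>N - \<bar>k\<bar>\<close> times, so the component
  of degree \<open>k\<close> has weight \<open>1 - \<bar>k\<bar> / N\<close>. The double sum makes
  the kernel a visible square.\<close>

definition cesaro :: "nat \<Rightarrow> 'b \<Rightarrow> 'b" where
  "cesaro N b = (1 / real N) *\<^sub>R (\<Sum>i<N. \<Sum>j<N. component (int j - int i) b)"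

text \<open>The means are integrals of the gauge orbit against the nonnegative kernel
  \<open>|\<Sum>j<N. cis (2 * pi * j * t)|\<^sup>2 / N\<close>, whose mass is 1.\<close>

lemma cesaro_norm_le:
  assumes "N > 0"
  shows "norm (cesaro N b) \<le> norm b"
proof -
  define D where "D = (\<lambda>t. \<Sum>j<N. cis (2 * pi * of_int (int j) * t))"
  define F where "F = (\<lambda>t. (cmod (D t))\<^sup>2)"
  have F: "complex_of_real (F t) = (\<Sum>i<N. \<Sum>j<N. cis (2 * pi * of_int (- (int j - int i)) * t))" for t
    unfolding F_def complex_norm_square D_def cnj_sum sum_product
    by (simp add: cis_cnj cis_mult algebra_simps)
  have "((\<lambda>t. complex_of_real (F t)) has_integral
      (\<Sum>i<N. \<Sum>j<N. if - (int j - int i) = 0 then 1 else 0)) {0..1}"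
    unfolding F by (intro has_integral_sum finite_lessThan has_integral_cis)
  \<comment> \<open>Only the \<open>N\<close> diagonal pairs contribute, so the unnormalised kernel
    has mass \<open>N\<close>, matching the factor \<open>1 / N\<close> in
    \<open>cesaro\<close>.\<close>
  from has_integral_linear[OF this bounded_linear_Re]
  have F1: "(F has_integral real N) {0..1}" by (simp add: o_def if_distrib[of Re] cong: if_cong)
  have "(\<Sum>i<N. \<Sum>j<N. cis (2 * pi * of_int (- (int j - int i)) * t) *\<^sub>C gauge t b) = F t *\<^sub>R gauge t b" for t
    unfolding scaleC_of_real[symmetric] F
    by (simp only: linear_sum[OF bounded_linear.linear[OF bounded_linear_scaleC_left]])
  moreover have "((\<lambda>t. \<Sum>i<N. \<Sum>j<N. cis (2 * pi * of_int (- (int j - int i)) * t) *\<^sub>C gauge t b) has_integral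
      (\<Sum>i<N. \<Sum>j<N. component (int j - int i) b)) {0..1}"
    by (intro has_integral_sum finite_lessThan component_has_integral)
  ultimately have int: "((\<lambda>t. F t *\<^sub>R gauge t b) has_integral (\<Sum>i<N. \<Sum>j<N. component (int j - int i) b)) {0..1}"
    by simp
  have "norm (\<Sum>i<N. \<Sum>j<N. component (int j - int i) b) \<le> integral {0..1} (\<lambda>t. F t * norm b)"
    unfolding integral_unique[OF int, symmetric]
  proof (rule integral_norm_bound_integral)
    show "(\<lambda>t. F t *\<^sub>R gauge t b) integrable_on {0..1}" using int by blast
    show "(\<lambda>t. F t * norm b) integrable_on {0..1}" using has_integral_mult_left[OF F1] by blast
    show "norm (F t *\<^sub>R gauge t b) \<le> F t * norm b" for t
      by (simp add: F_def mult_left_mono star_hom_norm_le gauge_hom)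
  qed
  also have "\<dots> = real N * norm b"
    using has_integral_mult_left[OF F1] by blast
  finally show ?thesis
    using assms by (simp add: cesaro_def field_simps)
qed

lemma bounded_linear_cesaro: "bounded_linear (cesaro N)"
  unfolding cesaro_def
  by (intro bounded_linear_const_scaleR bounded_linear_sum bounded_linear_component)

text \<open>A monomial of degree \<open>k\<close> is multiplied by the share of indices
  \<open>i\<close> for which \<open>i + k\<close> is an index too, and that share tends to
  1.\<close>

lemma cesaro_monomial_tendsto:
  "(\<lambda>N. cesaro N (\<iota> a * upow V k)) \<longlonglongrightarrow> \<iota> a * upow V k"
proof -
  let ?x = "\<iota> a * upow V k"
  define A where "A N = {i. i < N \<and> 0 \<le> int i + k \<and> int i + k < int N}" for N
  have "(\<Sum>i<N. \<Sum>j<N. component (int j - int i) ?x) = real (card (A N)) *\<^sub>R ?x" for N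
  proof -
    have "(\<Sum>j<N. component (int j - int i) ?x) = (if i \<in> A N then ?x else 0)" if "i < N" for i
    proof (cases "i \<in> A N")
      case True
      have "(\<Sum>j<N. component (int j - int i) ?x) = (\<Sum>j<N. if j = nat (int i + k) then ?x else 0)"
        using True by (intro sum.cong) (auto simp: component_monomial A_def)
      then show ?thesis using True by (auto simp: A_def)
    next
      case False
      then show ?thesis using that
        by (intro trans[OF sum.neutral]) (auto simp: component_monomial A_def)
    qed
    then have "(\<Sum>i<N. \<Sum>j<N. component (int j - int i) ?x) = (\<Sum>i<N. if i \<in> A N then ?x else 0)"
      by simp
    also have "\<dots> = (\<Sum>i\<in>A N. ?x)"
      by (rule sum.mono_neutral_cong_right) (auto simp: A_def)
    finally show ?thesis by (simp only: sum_constant_scaleR)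
  qed
  then have eq: "cesaro N ?x = (real (card (A N)) / real N) *\<^sub>R ?x" for N
    by (simp add: cesaro_def)
  have upper: "card (A N) \<le> N" for N
    using card_mono[of "{..<N}" "A N"] by (auto simp: A_def)
  have lower: "real N - \<bar>of_int k\<bar> \<le> card (A N)" for N
  proof -
    \<comment> \<open>One of \<open>nat k\<close> and \<open>nat (- k)\<close> is 0, so a single
      interval serves both signs of \<open>k\<close>; it has \<open>N - \<bar>k\<bar>\<close>
      elements, or none if that is negative.\<close>
    have "{nat (- k)..<N - nat k} \<subseteq> A N" by (auto simp: A_def)
    then have "card {nat (- k)..<N - nat k} \<le> card (A N)"
      by (rule card_mono[rotated]) (simp add: A_def)
    then show ?thesis by (simp; linarith)
  qed
  have "(\<lambda>N. real (card (A N)) / real N) \<longlonglongrightarrow> 1"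
  proof (rule tendsto_sandwich)
    show "(\<lambda>N. 1 - \<bar>of_int k\<bar> / real N) \<longlonglongrightarrow> 1"
      using tendsto_diff[OF tendsto_const[of 1] lim_const_over_n[of "\<bar>of_int k\<bar>"]] by simp
    show "\<forall>\<^sub>F N in sequentially. 1 - \<bar>of_int k\<bar> / real N \<le> real (card (A N)) / real N"
      using eventually_gt_at_top[of 0]
    proof eventually_elim
      case (elim N)
      then have "1 - \<bar>of_int k\<bar> / real N = (real N - \<bar>of_int k\<bar>) / real N"
        by (simp add: diff_divide_distrib)
      then show ?case using lower[of N] elim by (simp add: divide_right_mono)
    qed
    show "\<forall>\<^sub>F N in sequentially. real (card (A N)) / real N \<le> 1"
      using upper by (auto simp: divide_le_eq_1 intro!: always_eventually)
  qed simp
  then show ?thesis unfolding eq by (rule tendsto_eq_intros) auto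
qed

text \<open>All Fejer means of \<open>b\<close> reduce to \<open>component 0 b\<close>. They also
  approach \<open>b\<close>, because they converge on the dense set \<open>laurent\<close> and are
  contractive.\<close>

lemma eq_component_0:
  assumes "\<And>n. n \<noteq> 0 \<Longrightarrow> component n b = 0"
  shows "b = component 0 b"
proof -
  have lim: "(\<lambda>N. cesaro N p) \<longlonglongrightarrow> p" if "p \<in> laurent" for p
    using that
    by induction (auto simp: cesaro_monomial_tendsto linear_add bounded_linear.linear
        bounded_linear_cesaro intro: tendsto_add)
  have ces: "cesaro N b = component 0 b" if "N > 0" for N
  proof -
    have "component (int j - int i) b = (if j = i then component 0 b else 0)" for i j
      using assms[of "int j - int i"] by auto
    then show ?thesis using that by (simp add: cesaro_def sum_constant_scaleR del: sum_constant)
  qed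
  have "norm (b - component 0 b) \<le> 0"
  proof (rule field_le_epsilon)
    fix e :: real assume "e > 0"
    then obtain p where p: "p \<in> laurent" "norm (b - p) < e / 3"
      using laurent_approx[of "e / 3" b] by auto
    have "\<forall>\<^sub>F N in sequentially. dist (cesaro N p) p < e / 3"
      using lim[OF p(1)] \<open>e > 0\<close> by (intro tendstoD) auto
    then have "\<forall>\<^sub>F N in sequentially. dist (cesaro N p) p < e / 3 \<and> N > 0"
      using eventually_gt_at_top[of 0] by eventually_elim simp
    then obtain N where N: "dist (cesaro N p) p < e / 3" "N > 0"
      by (auto simp: eventually_sequentially)
    have "norm (cesaro N p - cesaro N b) \<le> norm (p - b)"
      using cesaro_norm_le[OF N(2), of "p - b"]
      by (simp add: linear_diff bounded_linear.linear bounded_linear_cesaro)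
    then show "norm (b - component 0 b) \<le> 0 + e"
      using p(2) N ces[OF N(2)] norm_triangle_ineq[of "b - p" "(p - cesaro N p) + (cesaro N p - cesaro N b)"]
        norm_triangle_ineq[of "p - cesaro N p" "cesaro N p - cesaro N b"]
      by (simp add: dist_norm norm_minus_commute)
  qed
  then show ?thesis by simp
qed

lemma monomial_not_scalar:
  assumes "n \<noteq> 0" "\<iota> a * upow V n = c *\<^sub>C 1"
  shows "a = 0"
proof -
  \<comment> \<open>This \<open>t\<close> makes the gauge automorphism act as -1 in degree
    \<open>n\<close>, while it fixes scalars.\<close>
  define t where "t = 1 / (2 * real_of_int n)"
  have "\<iota> a * upow V n = gauge t (\<iota> a * upow V n)"
    unfolding assms(2) by (simp add: gauge_simps)
  also have "\<dots> = cis pi *\<^sub>C (\<iota> a * upow V n)"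
    using assms(1) by (simp add: gauge_monomial t_def)
  finally have "2 *\<^sub>R (\<iota> a * upow V n) = 0"
    by (simp add: scaleC_minus_one scaleR_2 flip: eq_neg_iff_add_eq_0)
  then have "\<iota> a * upow V n = 0" by simp
  then have "\<iota> a * (upow V n * upow V (- n)) = 0" by (simp flip: mult.assoc)
  then have "\<iota> a = 0" by (simp add: unitary_V flip: upow_add)
  then show ?thesis by (metis embedding injD star_hom_zero)
qed

end

section \<open>Continuous functions and skew products\<close>

lemma unitary_mult_right_cancel:
  assumes "unitary (v :: 'a::cstar_algebra)" "x * v = y * v"
  shows "x = y"
proof -
  have "x * (v * v\<^sup>\<star>) = y * (v * v\<^sup>\<star>)" using assms(2) by (simp flip: mult.assoc)
  then show ?thesis using assms(1) by (simp add: unitary_def)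
qed

lemma scaleC_bcontfun_apply: "apply_bcontfun (c *\<^sub>C f) x = c * apply_bcontfun f x"
  by (simp add: scaleC_complex_def)

lemma star_mult_self_apply: "apply_bcontfun (f\<^sup>\<star> * f) x = complex_of_real ((cmod (apply_bcontfun f x))\<^sup>2)"
  by (simp add: star_complex_def complex_norm_square mult.commute del: of_real_power)

text \<open>Translates the circle-valued functions in the definitions of cocycle and coboundary into
  unitaries, which homomorphisms preserve.\<close>

lemma unitary_bcontfun_iff:
  "unitary f \<longleftrightarrow> (\<forall>x. cmod (apply_bcontfun f x) = 1)"
proof
  assume "unitary f"
  then have "apply_bcontfun (f\<^sup>\<star> * f) x = 1" for x by (simp add: unitary_def)
  then have "complex_of_real ((cmod (apply_bcontfun f x))\<^sup>2) = 1" for x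
    by (metis star_mult_self_apply)
  then show "\<forall>x. cmod (apply_bcontfun f x) = 1"
    unfolding of_real_eq_1_iff by (simp add: power2_eq_1_iff) (smt (verit) norm_ge_zero)
next
  assume *: "\<forall>x. cmod (apply_bcontfun f x) = 1"
  have "f\<^sup>\<star> * f = 1"
    by (rule bcontfun_eqI, subst star_mult_self_apply) (simp add: *)
  then show "unitary f" by (simp add: unitary_def mult.commute)
qed

lemma bounded_linear_eval: "bounded_linear (\<lambda>f. apply_bcontfun f x)"
  by (rule bounded_linear_intro[where K = 1]) (auto intro: norm_bounded)

text \<open>If \<open>\<parallel>\<iota> f\<parallel> < \<parallel>f\<parallel>\<close>, pick \<open>s\<close> strictly between the squares and put \<open>h = \<bar>f\<bar>\<^sup>2\<close>. The nonzero
  function \<open>k = max (h - s) 0\<close> satisfies \<open>h (max h s)\<^sup>-\<^sup>1 k = k\<close>, so \<open>\<iota> k\<close> is shrunk by the factor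
  \<open>\<parallel>\<iota> h\<parallel> / s < 1\<close> and vanishes.\<close>

lemma star_hom_inj_isometric:
  fixes \<iota> :: "('x::topological_space \<Rightarrow>\<^sub>C complex) \<Rightarrow> 'b::cstar_algebra"
  assumes hom: "star_hom \<iota>" and inj: "inj \<iota>"
  shows "norm (\<iota> f) = norm f"
proof (rule antisym[OF star_hom_norm_le[OF hom]], rule ccontr)
  assume "\<not> norm f \<le> norm (\<iota> f)"
  then have "(norm (\<iota> f))\<^sup>2 < (norm f)\<^sup>2" by (intro power_strict_mono) auto
  then obtain s where s: "(norm (\<iota> f))\<^sup>2 < s" "s < (norm f)\<^sup>2" using dense by blast
  have s0: "s > 0" using s(1) by (smt (verit) zero_le_power2)
  have "\<not> norm f \<le> sqrt s" using s s0 by (metis not_le norm_ge_zero real_le_rsqrt real_sqrt_le_iff real_sqrt_abs abs_of_nonneg)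
  then obtain x0 where x0: "s < (cmod (apply_bcontfun f x0))\<^sup>2"
    using norm_bound[of f "sqrt s"] by (meson not_le real_le_rsqrt)
  define p where "p = (\<lambda>x. (cmod (apply_bcontfun f x))\<^sup>2)"
  have p: "continuous_on UNIV p" unfolding p_def by (intro continuous_intros) auto
  have p_le: "p x \<le> (norm f)\<^sup>2" for x by (simp add: p_def power_mono norm_bounded)
  have inv_le: "\<bar>inverse (max (p x) s)\<bar> \<le> inverse s" for x
    using s0 by (auto simp: max_def abs_if intro!: le_imp_inverse_le)
  have k_le: "\<bar>max (p x - s) 0\<bar> \<le> (norm f)\<^sup>2" for x
    using s0 p_le[of x] by (auto simp: max_def)
  have g_in: "(\<lambda>x. complex_of_real (inverse (max (p x) s))) \<in> bcontfun"
  proof (rule bcontfun_normI)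
    show "continuous_on UNIV (\<lambda>x. complex_of_real (inverse (max (p x) s)))"
      using s0 by (intro continuous_intros p) (auto simp: max_def)
    show "cmod (complex_of_real (inverse (max (p x) s))) \<le> inverse s" for x
      by (simp only: norm_of_real inv_le)
  qed
  have k_in: "(\<lambda>x. complex_of_real (max (p x - s) 0)) \<in> bcontfun"
  proof (rule bcontfun_normI)
    show "continuous_on UNIV (\<lambda>x. complex_of_real (max (p x - s) 0))"
      by (intro continuous_intros p)
    show "cmod (complex_of_real (max (p x - s) 0)) \<le> (norm f)\<^sup>2" for x
      by (simp only: norm_of_real k_le)
  qed
  define g where "g = Bcontfun (\<lambda>x. complex_of_real (inverse (max (p x) s)))"
  define k where "k = Bcontfun (\<lambda>x. complex_of_real (max (p x - s) 0))"
  have g: "apply_bcontfun g x = complex_of_real (inverse (max (p x) s))" for x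
    unfolding g_def Bcontfun_inverse[OF g_in] ..
  have k: "apply_bcontfun k x = complex_of_real (max (p x - s) 0)" for x
    unfolding k_def Bcontfun_inverse[OF k_in] ..
  have "(f\<^sup>\<star> * f) * g * k = k"
  proof (rule bcontfun_eqI)
    fix x
    \<comment> \<open>Where \<open>p x > s\<close> the first two factors cancel; elsewhere the last
      one vanishes.\<close>
    have "p x * inverse (max (p x) s) * max (p x - s) 0 = max (p x - s) 0"
      using s0 by (auto simp: max_def)
    moreover have "apply_bcontfun (f\<^sup>\<star> * f) x = complex_of_real (p x)"
      by (simp only: star_mult_self_apply p_def)
    ultimately show "apply_bcontfun ((f\<^sup>\<star> * f) * g * k) x = apply_bcontfun k x"
      by (simp only: times_bcontfun.rep_eq[of "_ * _"] g k flip: of_real_mult)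
  qed
  then have "\<iota> k = (\<iota> f)\<^sup>\<star> * \<iota> f * \<iota> g * \<iota> k" by (metis hom star_hom_mult star_hom_star)
  then have "norm (\<iota> k) \<le> norm ((\<iota> f)\<^sup>\<star> * \<iota> f) * norm (\<iota> g) * norm (\<iota> k)"
    by (metis (no_types, opaque_lifting) mult_right_mono norm_ge_zero norm_mult_ineq order_trans)
  also have "\<dots> \<le> (norm (\<iota> f))\<^sup>2 * (1 / s) * norm (\<iota> k)"
  proof -
    have "norm (\<iota> g) \<le> norm g" by (rule star_hom_norm_le[OF hom])
    also have "norm g \<le> 1 / s"
      by (rule norm_bound) (simp only: g norm_of_real inv_le flip: inverse_eq_divide)
    finally show ?thesis
      unfolding cstar_identity by (intro mult_right_mono mult_left_mono) auto
  qed
  finally have "s * norm (\<iota> k) \<le> (norm (\<iota> f))\<^sup>2 * norm (\<iota> k)" using s0 by (simp add: field_simps)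
  then have "\<iota> k = 0" using s(1) by (simp add: mult_le_cancel_right)
  then have "k = 0" by (metis hom inj injD star_hom_zero)
  then have "apply_bcontfun k x0 = 0" by simp
  then have "max (p x0 - s) 0 = 0" unfolding k of_real_eq_0_iff .
  then show False using x0 by (simp add: p_def max_def split: if_splits)
qed

text \<open>The mean of \<open>g \<mapsto> \<theta>\<^sub>-\<^sub>g b x\<close> is an invariant state, which takes the value \<open>f x\<close> at a fixed
  function \<open>f\<close>. Since there is only one invariant state, \<open>f\<close> is constant.\<close>

lemma uniquely_ergodic_fixed_constant:
  fixes \<theta> :: "'g::topological_group_add \<Rightarrow> ('x::topological_space \<Rightarrow>\<^sub>C complex) \<Rightarrow> ('x \<Rightarrow>\<^sub>C complex)"
  assumes amenable: "amenable_group TYPE('g)" and sys: "cstar_dynamical_system \<theta>"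
    and erg: "uniquely_ergodic \<theta>" and fixed: "\<And>g. \<theta> g f = f"
  shows "apply_bcontfun f x = apply_bcontfun f y"
proof -
  obtain \<mu> :: "'g measure" and m where mean: "left_invariant_mean \<mu> m"
    using amenable by (auto simp: amenable_group_def)
  define L where "L = {h :: 'g \<Rightarrow> real. h \<in> borel_measurable borel \<and> bounded (range h)}"
  have m_add: "\<And>h k. h \<in> L \<Longrightarrow> k \<in> L \<Longrightarrow> m (\<lambda>x. h x + k x) = m h + m k"
    and m_mult: "\<And>c h. h \<in> L \<Longrightarrow> m (\<lambda>x. c * h x) = c * m h"
    and m_nonneg: "\<And>h. h \<in> L \<Longrightarrow> (\<And>x. 0 \<le> h x) \<Longrightarrow> 0 \<le> m h"
    and m_one: "m (\<lambda>_. 1) = 1"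
    and m_shift: "\<And>g h. h \<in> L \<Longrightarrow> m (\<lambda>x. h (g + x)) = m h"
    using mean unfolding left_invariant_mean_def Let_def L_def[symmetric] by blast+
  have L_mult: "(\<lambda>x. c * h x) \<in> L" if "h \<in> L" for c h
    using that bounded_scaling[of "range h" c] by (auto simp: L_def image_image)
  have m_const: "m (\<lambda>_. c) = c" for c
    using m_mult[of "\<lambda>_. 1" c] by (simp add: m_one L_def)
  have hom: "star_hom (\<theta> g)" for g
    using sys by (auto simp: cstar_dynamical_system_def star_automorphism_def)
  \<comment> \<open>The inverse turns composition with \<open>\<theta> h\<close> into a left
    translation by \<open>- h\<close> in the variable \<open>g\<close>, which is the side on which
    the mean is invariant.\<close>
  define F where "F = (\<lambda>x b g. apply_bcontfun (\<theta> (- g) b) x)"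
  \<comment> \<open>The mean acts on real functions, so it is applied to real and imaginary parts
    separately.\<close>
  define \<phi> where "\<phi> = (\<lambda>x b. Complex (m (\<lambda>g. Re (F x b g))) (m (\<lambda>g. Im (F x b g))))"
  have F_L: "(\<lambda>g. Re (F x b g)) \<in> L" "(\<lambda>g. Im (F x b g)) \<in> L" for x b
  proof -
    have "continuous_on UNIV (\<lambda>g. \<theta> g b)"
      using sys by (simp add: cstar_dynamical_system_def)
    then have "continuous_on UNIV (\<lambda>g. \<theta> (- g) b)"
      by (rule continuous_on_compose2[OF _ continuous_on_minus[OF continuous_on_id]]) simp
    then have c: "continuous_on UNIV (F x b)"
      unfolding F_def by (rule bounded_linear.continuous_on[OF bounded_linear_eval])
    have le: "cmod (F x b g) \<le> norm b" for g
      unfolding F_def using norm_bounded star_hom_norm_le[OF hom] order_trans by blast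
    have "bounded (range (\<lambda>g. Re (F x b g)))" "bounded (range (\<lambda>g. Im (F x b g)))"
      using order_trans[OF abs_Re_le_cmod le] order_trans[OF abs_Im_le_cmod le]
      by (auto simp: bounded_iff)
    then show "(\<lambda>g. Re (F x b g)) \<in> L" "(\<lambda>g. Im (F x b g)) \<in> L"
      by (auto simp: L_def intro!: borel_measurable_continuous_onI continuous_intros c)
  qed
  have "state (\<phi> x)" for x
    unfolding state_def
  proof (intro conjI allI)
    show "\<phi> x (a + b) = \<phi> x a + \<phi> x b" for a b
      by (simp add: \<phi>_def F_def star_hom_add[OF hom] complex_eq_iff m_add F_L[unfolded F_def])
    show "\<phi> x (c *\<^sub>C b) = c * \<phi> x b" for c b
    proof -
      have F: "F x (c *\<^sub>C b) g = c * F x b g" for g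
        by (simp only: F_def star_hom_scaleC[OF hom] scaleC_bcontfun_apply)
      have "m (\<lambda>g. Re c * Re (F x b g) + (- Im c) * Im (F x b g)) =
          Re c * m (\<lambda>g. Re (F x b g)) + (- Im c) * m (\<lambda>g. Im (F x b g))"
        by (simp only: m_add[OF L_mult[OF F_L(1)] L_mult[OF F_L(2)]] m_mult[OF F_L(1)] m_mult[OF F_L(2)])
      moreover have "m (\<lambda>g. Re c * Im (F x b g) + Im c * Re (F x b g)) =
          Re c * m (\<lambda>g. Im (F x b g)) + Im c * m (\<lambda>g. Re (F x b g))"
        by (simp only: m_add[OF L_mult[OF F_L(2)] L_mult[OF F_L(1)]] m_mult[OF F_L(1)] m_mult[OF F_L(2)])
      ultimately show ?thesis
        by (simp add: \<phi>_def F complex_eq_iff)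
    qed
    show "\<phi> x (b\<^sup>\<star> * b) \<in> \<real>\<^sub>\<ge>\<^sub>0" for b
    proof -
      \<comment> \<open>A squared modulus: the real part has nonnegative mean and the imaginary part
        is zero.\<close>
      have F: "F x (b\<^sup>\<star> * b) g = complex_of_real ((cmod (F x b g))\<^sup>2)" for g
        by (simp only: F_def star_hom_mult[OF hom] star_hom_star[OF hom] star_mult_self_apply)
      have "0 \<le> m (\<lambda>g. Re (F x (b\<^sup>\<star> * b) g))"
        by (rule m_nonneg[OF F_L(1)]) (simp add: F del: of_real_power)
      then show ?thesis
        by (simp add: \<phi>_def complex_nonneg_Reals_iff F m_const del: of_real_power)
    qed
    show "\<phi> x 1 = 1"
      by (simp add: \<phi>_def F_def star_hom_one[OF hom] m_const complex_eq_iff)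
  qed
  moreover have "\<phi> x \<circ> \<theta> h = \<phi> x" for x h
  proof
    fix b
    have "\<theta> (- g) (\<theta> h b) = \<theta> (- (- h + g)) b" for g
      using sys by (simp add: cstar_dynamical_system_def minus_add)
    then have "F x (\<theta> h b) g = F x b (- h + g)" for g by (simp add: F_def)
    then show "(\<phi> x \<circ> \<theta> h) b = \<phi> x b"
      using m_shift[OF F_L(1), of x b "- h"] m_shift[OF F_L(2), of x b "- h"] by (simp add: \<phi>_def)
  qed
  ultimately have inv: "state (\<phi> x) \<and> (\<forall>g. \<phi> x \<circ> \<theta> g = \<phi> x)" for x
    by blast
  have "\<phi> x = \<phi> y"
    using the1_equality[OF erg[unfolded uniquely_ergodic_def], OF inv[of x]]
      the1_equality[OF erg[unfolded uniquely_ergodic_def], OF inv[of y]] by (rule trans[OF sym])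
  then have "\<phi> x f = \<phi> y f" by (rule fun_cong)
  then show ?thesis
    by (simp add: \<phi>_def F_def fixed m_const complex_eq_iff)
qed

section \<open>Coboundaries and solutions of the equation\<close>

text \<open>A function \<open>w\<close> that witnesses the coboundary is itself a nonzero solution.
  Conversely a nonzero solution has constant modulus and is rescaled to such a
  \<open>w\<close>.\<close>

lemma coboundary_iff_solution:
  fixes \<theta> :: "'g::topological_group_add \<Rightarrow> ('x::topological_space \<Rightarrow>\<^sub>C complex) \<Rightarrow> ('x \<Rightarrow>\<^sub>C complex)"
  assumes "amenable_group TYPE('g)" and sys: "cstar_dynamical_system \<theta>"
    and "uniquely_ergodic \<theta>" and v: "\<And>g. unitary (v g)"
  shows "continuous_coboundary \<theta> v \<longleftrightarrow> (\<exists>a. a \<noteq> 0 \<and> (\<forall>g. \<theta> g a * v g = a))"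
proof
  have hom: "star_hom (\<theta> g)" for g
    using sys by (auto simp: cstar_dynamical_system_def star_automorphism_def)
  assume "continuous_coboundary \<theta> v"
  then obtain w where w: "unitary w" and vw: "\<And>g. v g = \<theta> g (w\<^sup>\<star>) * w"
    by (auto simp: continuous_coboundary_def unitary_bcontfun_iff)
  have "\<theta> g w * v g = \<theta> g (w * w\<^sup>\<star>) * w" for g
    by (simp add: vw star_hom_mult[OF hom] mult.assoc)
  then have "\<theta> g w * v g = w" for g
    using w by (simp add: unitary_def star_hom_one[OF hom])
  moreover have "w \<noteq> 0" using unitary_norm[OF w] by auto
  ultimately show "\<exists>a. a \<noteq> 0 \<and> (\<forall>g. \<theta> g a * v g = a)" by blast
next
  have hom: "star_hom (\<theta> g)" for g
    using sys by (auto simp: cstar_dynamical_system_def star_automorphism_def)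
  assume "\<exists>a. a \<noteq> 0 \<and> (\<forall>g. \<theta> g a * v g = a)"
  then obtain a x where a: "\<And>g. \<theta> g a * v g = a" and x: "apply_bcontfun a x \<noteq> 0"
    by (metis bcontfun_eqI zero_bcontfun.rep_eq)
  have "\<theta> g (a\<^sup>\<star> * a) = a\<^sup>\<star> * a" for g
  proof -
    \<comment> \<open>By commutativity the unitary \<open>v g\<close> meets its adjoint and drops
      out, so the squared modulus of \<open>a\<close> is fixed.\<close>
    have "(\<theta> g a * v g)\<^sup>\<star> * (\<theta> g a * v g) = ((v g)\<^sup>\<star> * v g) * ((\<theta> g a)\<^sup>\<star> * \<theta> g a)"
      by (simp only: star_mult ac_simps)
    then have "a\<^sup>\<star> * a = (\<theta> g a)\<^sup>\<star> * \<theta> g a" using v[of g] by (simp add: unitary_def a)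
    moreover have "\<theta> g (a\<^sup>\<star> * a) = (\<theta> g a)\<^sup>\<star> * \<theta> g a"
      by (simp only: star_hom_mult[OF hom] star_hom_star[OF hom])
    ultimately show ?thesis by (rule trans[OF _ sym, rotated])
  qed
  then have "apply_bcontfun (a\<^sup>\<star> * a) y = apply_bcontfun (a\<^sup>\<star> * a) x" for y
    by (rule uniquely_ergodic_fixed_constant[OF assms(1,2,3)])
  then have "(cmod (apply_bcontfun a y))\<^sup>2 = (cmod (apply_bcontfun a x))\<^sup>2" for y
    unfolding star_mult_self_apply of_real_eq_iff .
  then have abs: "cmod (apply_bcontfun a y) = cmod (apply_bcontfun a x)" for y
    by (rule power2_eq_imp_eq) simp_all
  \<comment> \<open>As the modulus is constant, dividing by its nonzero value at the one point
    \<open>x\<close> normalises \<open>a\<close> everywhere.\<close>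
  define w where "w = complex_of_real (1 / cmod (apply_bcontfun a x)) *\<^sub>C a"
  have w: "cmod (apply_bcontfun w y) = 1" for y
    unfolding w_def scaleC_bcontfun_apply using x by (simp add: norm_mult norm_divide abs[of y])
  then have ww: "w\<^sup>\<star> * w = 1" using unitary_bcontfun_iff[of w] by (simp add: unitary_def)
  have wv: "\<theta> g w * v g = w" for g
    unfolding w_def by (simp only: star_hom_scaleC[OF hom] scaleC_mult_left a)
  have "\<theta> g (w\<^sup>\<star> * w) * v g = \<theta> g (w\<^sup>\<star>) * (\<theta> g w * v g)" for g
    by (simp only: star_hom_mult[OF hom] mult.assoc)
  then have "v g = \<theta> g (w\<^sup>\<star>) * w" for g
    by (simp add: ww wv star_hom_one[OF hom])
  then show "continuous_coboundary \<theta> v"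
    using w unfolding continuous_coboundary_def by blast
qed

section \<open>Recursion for the iterated cocycles\<close>

lemma iterated_cocycle_0: "iterated_cocycle \<alpha> u 0 g = 1"
  by (simp add: iterated_cocycle_def)

lemma unitary_prod:
  fixes f :: "'i \<Rightarrow> 'x::topological_space \<Rightarrow>\<^sub>C complex"
  shows "(\<And>i. i \<in> A \<Longrightarrow> unitary (f i)) \<Longrightarrow> unitary (\<Prod>i\<in>A. f i)"
  by (induction A rule: infinite_finite_induct) (auto simp: unitary_mult, auto simp: unitary_def)

lemma unitary_iterated_cocycle:
  assumes "star_automorphism \<alpha>" "unitary (u g)"
  shows "unitary (iterated_cocycle \<alpha> u n g)"
proof -
  have "unitary ((u g)\<^sup>\<star>)" using assms(2) by (simp add: unitary_def star_star)
  then show ?thesis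
    unfolding iterated_cocycle_def
    by (auto intro!: unitary_prod star_hom_unitary[OF star_automorphism_fun_powi[OF assms(1)]] assms(2))
qed

text \<open>One recursion for both signs: for nonnegative \<open>n\<close> a factor is appended, for
  negative \<open>n\<close> the new factor cancels the one of index \<open>n\<close>.\<close>

lemma iterated_cocycle_succ:
  assumes \<alpha>: "star_automorphism \<alpha>" and u: "unitary (u g)"
  shows "iterated_cocycle \<alpha> u (n + 1) g = iterated_cocycle \<alpha> u n g * fun_powi \<alpha> n (u g)"
proof (cases "n \<ge> 0")
  case True
  then have "{0..<n + 1} = insert n {0..<n}" by auto
  then show ?thesis using True by (simp add: iterated_cocycle_def mult.commute)
next
  case False
  then have ins: "{n..<0} = insert n {n + 1..<0}" by auto
  have "fun_powi \<alpha> n ((u g)\<^sup>\<star>) * fun_powi \<alpha> n (u g) = 1"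
    using star_hom_unitary[OF star_automorphism_fun_powi[OF \<alpha>] u, of n]
    by (simp add: unitary_def star_hom_star[OF star_automorphism_fun_powi[OF \<alpha>]])
  then have "fun_powi \<alpha> n ((u g)\<^sup>\<star>) * P * fun_powi \<alpha> n (u g) = P" for P
    by (simp add: mult.assoc mult.left_commute[of _ P])
  then have "(\<Prod>k\<in>{n..<0}. fun_powi \<alpha> k ((u g)\<^sup>\<star>)) * fun_powi \<alpha> n (u g) =
      (\<Prod>k\<in>{n + 1..<0}. fun_powi \<alpha> k ((u g)\<^sup>\<star>))"
    unfolding ins by simp
  \<comment> \<open>At \<open>n = -1\<close> the successor 0 falls in the other branch of the
    definition; both products are empty there.\<close>
  then show ?thesis using False by (cases "n = -1") (auto simp: iterated_cocycle_def)
qed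

section \<open>The skew product action and its fixed points\<close>

locale skew_product = crossed_product \<alpha> \<iota> V
  for \<alpha> :: "('x::topological_space \<Rightarrow>\<^sub>C complex) \<Rightarrow> ('x \<Rightarrow>\<^sub>C complex)"
    and \<iota> :: "('x \<Rightarrow>\<^sub>C complex) \<Rightarrow> 'b::cstar_algebra" and V +
  fixes \<theta> :: "'g::topological_group_add \<Rightarrow> ('x \<Rightarrow>\<^sub>C complex) \<Rightarrow> ('x \<Rightarrow>\<^sub>C complex)"
    and u :: "'g \<Rightarrow> ('x \<Rightarrow>\<^sub>C complex)"
  assumes system: "cstar_dynamical_system \<theta>"
    and commute: "\<alpha> (\<theta> g a) = \<theta> g (\<alpha> a)"
    and cocycle: "continuous_cocycle \<theta> u"
begin

lemma action_hom: "star_hom (\<theta> g)"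
  and action_add: "\<theta> (g + h) a = \<theta> g (\<theta> h a)"
  using system by (auto simp: cstar_dynamical_system_def star_automorphism_def)

text \<open>The homomorphism law makes \<open>\<theta> 0\<close> idempotent, and an injective
  idempotent map is the identity.\<close>

lemma action_0: "\<theta> 0 a = a"
proof -
  have "inj (\<theta> 0)"
    using system by (auto simp: cstar_dynamical_system_def star_automorphism_def bij_is_inj)
  then show ?thesis using action_add[of 0 0 a] by (simp add: inj_def)
qed

lemma cocycle_unitary: "unitary (u g)"
  using cocycle by (simp add: continuous_cocycle_def unitary_bcontfun_iff)

lemma cocycle_add: "u (g + h) = \<theta> g (u h) * u g"
  using cocycle by (simp add: continuous_cocycle_def)

lemma cocycle_0: "u 0 = 1"
proof -
  have "u 0 * u 0 = 1 * u 0" using cocycle_add[of 0 0] by (simp add: action_0)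
  then show ?thesis by (rule unitary_mult_right_cancel[OF cocycle_unitary])
qed

lemma unitary_iterated: "unitary (iterated_cocycle \<alpha> u n g)"
  by (intro unitary_iterated_cocycle automorphism cocycle_unitary)

text \<open>The pair is covariant because \<open>\<alpha>\<close> commutes with
  \<open>\<theta> g\<close> and because \<open>u g\<close> can be moved past coefficients in the
  commutative function algebra.\<close>

lemma skew_hom_exists:
  obtains \<rho> where "star_hom \<rho>" "\<And>a. \<rho> (\<iota> a) = \<iota> (\<theta> g a)" "\<rho> V = \<iota> (u g) * V"
proof (rule covariant_extension[of "\<iota> \<circ> \<theta> g" "\<iota> (u g) * V"])
  show "\<iota> (u g) * V * (\<iota> \<circ> \<theta> g) a = (\<iota> \<circ> \<theta> g) (\<alpha> a) * (\<iota> (u g) * V)" for a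
  proof -
    have "\<iota> (u g) * V * \<iota> (\<theta> g a) = \<iota> (u g * \<theta> g (\<alpha> a)) * V"
      by (simp add: mult.assoc V_embedding commute embedding_simps)
    also have "\<dots> = \<iota> (\<theta> g (\<alpha> a)) * (\<iota> (u g) * V)"
      by (simp add: mult.commute[of "u g"] embedding_simps mult.assoc)
    finally show ?thesis by simp
  qed
qed (use that in \<open>auto intro: star_hom_comp embedding action_hom unitary_mult
      star_hom_unitary[OF embedding(1)] cocycle_unitary unitary_V\<close>)

abbreviation \<Phi> :: "'g \<Rightarrow> 'b \<Rightarrow> 'b" where "\<Phi> \<equiv> skew_product_action \<theta> u \<iota> V"

text \<open>Shows that the definite description in \<open>skew_product_action\<close> denotes: the
  homomorphism for \<open>- g\<close> inverts the one for \<open>g\<close>, and the generators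
  determine it.\<close>

lemma skew: "star_automorphism (\<Phi> g) \<and> (\<forall>a. \<Phi> g (\<iota> a) = \<iota> (\<theta> g a)) \<and> \<Phi> g V = \<iota> (u g) * V"
proof -
  obtain \<rho> where \<rho>: "star_hom \<rho>" "\<And>a. \<rho> (\<iota> a) = \<iota> (\<theta> g a)" "\<rho> V = \<iota> (u g) * V"
    using skew_hom_exists by metis
  obtain \<sigma> where \<sigma>: "star_hom \<sigma>" "\<And>a. \<sigma> (\<iota> a) = \<iota> (\<theta> (- g) a)" "\<sigma> V = \<iota> (u (- g)) * V"
    using skew_hom_exists by metis
  \<comment> \<open>The cocycle identity computes the composite at \<open>V\<close>; for
    \<open>h\<close> and \<open>k\<close> opposite the factor becomes
    \<open>u 0 = 1\<close>.\<close>
  have one: "\<iota> (\<theta> h (u k)) * (\<iota> (u h) * V) = \<iota> (u (h + k)) * V" for h k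
    by (simp add: cocycle_add embedding_simps mult.assoc)
  have "\<rho> \<circ> \<sigma> = id"
    by (rule hom_eqI)
      (auto simp: \<rho> \<sigma> star_hom_comp star_hom_id star_homD[OF \<rho>(1)] one cocycle_0 embedding_simps action_0
        simp flip: action_add)
  moreover have "\<sigma> \<circ> \<rho> = id"
    by (rule hom_eqI)
      (auto simp: \<rho> \<sigma> star_hom_comp star_hom_id star_homD[OF \<sigma>(1)] one cocycle_0 embedding_simps action_0
        simp flip: action_add)
  ultimately have "star_automorphism \<rho>"
    using \<rho>(1) by (simp add: star_automorphism_def o_bij)
  then have "\<exists>!\<Psi>. star_automorphism \<Psi> \<and> (\<forall>a. \<Psi> (\<iota> a) = \<iota> (\<theta> g a)) \<and> \<Psi> V = \<iota> (u g) * V"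
    using \<rho> by (intro ex1I[of _ \<rho>]) (auto intro!: hom_eqI simp: star_automorphism_def)
  from theI'[OF this] show ?thesis unfolding skew_product_action_def .
qed

lemma skew_hom: "star_hom (\<Phi> g)"
  and skew_embedding: "\<Phi> g (\<iota> a) = \<iota> (\<theta> g a)"
  and skew_V: "\<Phi> g V = \<iota> (u g) * V"
  using skew by (auto simp: star_automorphism_def)

lemmas skew_simps = star_homD[OF skew_hom]

lemma skew_upow: "\<Phi> g (upow V n) = \<iota> (iterated_cocycle \<alpha> u n g) * upow V n"
proof -
  let ?c = "\<lambda>n. iterated_cocycle \<alpha> u n g"
  have succ: "\<iota> (?c n) * upow V n * (\<iota> (u g) * V) = \<iota> (?c (n + 1)) * upow V (n + 1)" for n
  proof -
    have "\<iota> (?c n) * upow V n * (\<iota> (u g) * V) = \<iota> (?c n) * (upow V n * \<iota> (u g)) * V"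
      by (simp add: mult.assoc)
    then show ?thesis
      by (simp add: upow_embedding iterated_cocycle_succ[where \<alpha> = \<alpha>] automorphism cocycle_unitary
          embedding_simps upow_succ unitary_V mult.assoc)
  qed
  have unit: "unitary (\<iota> (u g) * V)"
    by (intro unitary_mult unitary_V star_hom_unitary[OF embedding(1)] cocycle_unitary)
  show ?thesis
  proof (induction n rule: int_induct[where k = 0])
    case base
    then show ?case by (simp add: iterated_cocycle_0 skew_simps embedding_simps)
  next
    case (step1 i)
    have "\<Phi> g (upow V (i + 1)) = \<Phi> g (upow V i) * \<Phi> g V"
      by (simp add: upow_succ unitary_V skew_simps)
    then show ?case using step1(2) succ[of i] by (simp add: skew_V)
  next
    case (step2 i)
    \<comment> \<open>The recursion runs upwards only, so the downward step multiplies by the image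
      of \<open>V\<close> and cancels this unitary.\<close>
    have "\<Phi> g (upow V (i - 1)) * (\<iota> (u g) * V) = \<Phi> g (upow V i)"
      using upow_succ[OF unitary_V, of "i - 1"] by (simp add: skew_simps flip: skew_V)
    also have "\<dots> = \<iota> (?c (i - 1)) * upow V (i - 1) * (\<iota> (u g) * V)"
      using step2(2) succ[of "i - 1"] by simp
    finally show ?case by (rule unitary_mult_right_cancel[OF unit])
  qed
qed

lemma skew_monomial:
  "\<Phi> g (\<iota> a * upow V n) = \<iota> (\<theta> g a * iterated_cocycle \<alpha> u n g) * upow V n"
  by (simp add: skew_simps skew_embedding skew_upow embedding_simps mult.assoc)

text \<open>Both composites agree on the generators: the gauge action fixes the factor
  \<open>\<iota> (u g)\<close> and multiplies \<open>V\<close> by a scalar.\<close>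

lemma skew_gauge: "\<Phi> g (gauge t b) = gauge t (\<Phi> g b)"
proof -
  have "\<Phi> g \<circ> gauge t = gauge t \<circ> \<Phi> g"
    by (rule hom_eqI)
      (auto intro: star_hom_comp skew_hom gauge_hom
        simp: gauge_embedding skew_embedding gauge_V skew_V skew_simps gauge_simps scaleC_mult_right)
  then show ?thesis by (metis comp_apply)
qed

text \<open>An injective homomorphism on the function algebra is isometric, so its range is
  complete.\<close>

lemma closed_range_embedding: "closed (range \<iota>)"
proof -
  have "complete (\<iota> ` UNIV)"
    by (rule complete_isometric_image[where e = 1])
      (auto simp: star_hom_inj_isometric embedding star_hom_bounded_linear complete_UNIV)
  then show ?thesis by (rule complete_imp_closed)
qed

text \<open>A monomial of degree \<open>n\<close> is fixed by the skew product exactly when its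
  coefficient solves the equation, and all components of a fixed element are fixed
  monomials.\<close>

lemma weakly_ergodic_iff:
  assumes "amenable_group TYPE('g)" and "uniquely_ergodic \<theta>"
  shows "weakly_ergodic \<Phi> \<longleftrightarrow>
    (\<forall>n. n \<noteq> 0 \<longrightarrow> (\<forall>a. (\<forall>g. \<theta> g a * iterated_cocycle \<alpha> u n g = a) \<longrightarrow> a = 0))"
proof (intro iffI allI impI)
  fix n a
  assume "weakly_ergodic \<Phi>" "n \<noteq> 0" and a: "\<forall>g. \<theta> g a * iterated_cocycle \<alpha> u n g = a"
  have "\<iota> a * upow V n \<in> fixed_point_subalgebra \<Phi>"
    using a by (simp add: fixed_point_subalgebra_def skew_monomial)
  then show "a = 0"
    using \<open>weakly_ergodic \<Phi>\<close> monomial_not_scalar[OF \<open>n \<noteq> 0\<close>] by (auto simp: weakly_ergodic_def)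
next
  assume sol: "\<forall>n. n \<noteq> 0 \<longrightarrow> (\<forall>a. (\<forall>g. \<theta> g a * iterated_cocycle \<alpha> u n g = a) \<longrightarrow> a = 0)"
  have "b \<in> range (\<lambda>c. c *\<^sub>C 1)" if b: "\<And>g. \<Phi> g b = b" for b
  proof -
    have component: "\<exists>a. component n b = \<iota> a * upow V n \<and> (\<forall>g. \<theta> g a * iterated_cocycle \<alpha> u n g = a)" for n
    proof -
      obtain a where a: "component n b = \<iota> a * upow V n"
        using component_in_range[OF closed_range_embedding] by blast
      have "\<theta> g a * iterated_cocycle \<alpha> u n g = a" for g
      proof -
        have "\<Phi> g (component n b) = component n (\<Phi> g b)"
          by (intro component_commute star_hom_bounded_linear skew_hom skew_simps skew_gauge)
        then have "\<iota> (\<theta> g a * iterated_cocycle \<alpha> u n g) * upow V n = \<iota> a * upow V n"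
          by (simp add: b a skew_monomial)
        then have "\<iota> (\<theta> g a * iterated_cocycle \<alpha> u n g) = \<iota> a"
          by (rule unitary_mult_right_cancel[OF unitary_upow[OF unitary_V]])
        then show ?thesis using embedding(2) by (simp add: inj_def)
      qed
      with a show ?thesis by blast
    qed
    have "component n b = 0" if "n \<noteq> 0" for n
    proof -
      obtain a where "component n b = \<iota> a * upow V n"
        and "\<forall>g. \<theta> g a * iterated_cocycle \<alpha> u n g = a"
        using component[of n] by blast
      moreover from this have "a = 0" using sol that by blast
      ultimately show ?thesis by (simp add: star_hom_zero embedding)
    qed
    then have "b = component 0 b" by (rule eq_component_0)
    \<comment> \<open>In degree 0 the iterated cocycle is 1, so the equation says that
      \<open>a\<close> is fixed by \<open>\<theta>\<close>; unique ergodicity then makes it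
      constant.\<close>
    then obtain a where a: "b = \<iota> a" "\<And>g. \<theta> g a = a"
      using component[of 0] by (auto simp: iterated_cocycle_0)
    obtain c where c: "\<And>x. apply_bcontfun a x = c"
      using uniquely_ergodic_fixed_constant[OF assms(1) system assms(2) a(2)] by metis
    have "a = c *\<^sub>C 1"
      by (rule bcontfun_eqI) (simp only: scaleC_bcontfun_apply one_bcontfun.rep_eq mult_1_right c)
    then show ?thesis using a(1) by (auto simp: embedding_simps)
  qed
  then have "fixed_point_subalgebra \<Phi> \<subseteq> range (\<lambda>c. c *\<^sub>C 1)"
    unfolding fixed_point_subalgebra_def by blast
  moreover have "c *\<^sub>C 1 \<in> fixed_point_subalgebra \<Phi>" for c
    by (simp add: fixed_point_subalgebra_def skew_simps)
  ultimately show "weakly_ergodic \<Phi>"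
    unfolding weakly_ergodic_def by (intro equalityI image_subsetI)
qed

end

theorem proposition3p4:
  fixes \<theta> :: "'g::{topological_group_add, t2_space, second_countable_topology} \<Rightarrow>
      ('x::topological_space \<Rightarrow>\<^sub>C complex) \<Rightarrow> ('x \<Rightarrow>\<^sub>C complex)"
    and \<alpha> :: "('x \<Rightarrow>\<^sub>C complex) \<Rightarrow> ('x \<Rightarrow>\<^sub>C complex)"
    and u :: "'g \<Rightarrow> ('x \<Rightarrow>\<^sub>C complex)"
    and \<iota> :: "('x \<Rightarrow>\<^sub>C complex) \<Rightarrow> 'b::cstar_algebra"
    and V :: 'b
  assumes "compact (UNIV :: 'x set)"
    and "metrizable_space (euclidean :: 'x topology)"
    and "locally_compact_space (euclidean :: 'g topology)"
    and "unimodular_group TYPE('g)"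
    and "amenable_group TYPE('g)"
    and "cstar_dynamical_system \<theta>"
    and "uniquely_ergodic \<theta>"
    and "star_automorphism \<alpha>"
    and "\<And>g. \<alpha> \<circ> \<theta> g = \<theta> g \<circ> \<alpha>"
    and "continuous_cocycle \<theta> u"
    and "universal_crossed_product \<alpha> \<iota> V"
  shows "(weakly_ergodic (skew_product_action \<theta> u \<iota> V) \<longleftrightarrow>
           (\<forall>n. n \<noteq> 0 \<longrightarrow> \<not> continuous_coboundary \<theta> (iterated_cocycle \<alpha> u n))) \<and>
         (weakly_ergodic (skew_product_action \<theta> u \<iota> V) \<longleftrightarrow>
           (\<forall>n. n \<noteq> 0 \<longrightarrow> (\<forall>a. (\<forall>g. \<theta> g a * iterated_cocycle \<alpha> u n g = a) \<longrightarrow> a = 0)))"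
proof -
  interpret skew_product \<alpha> \<iota> V \<theta> u
  proof
    show "\<alpha> (\<theta> g a) = \<theta> g (\<alpha> a)" for g a
      using fun_cong[OF assms(9)[of g], of a] by simp
  qed (rule assms)+
  have solvable: "\<not> (\<exists>a :: 'x \<Rightarrow>\<^sub>C complex. a \<noteq> 0 \<and> P a) \<longleftrightarrow> (\<forall>a. P a \<longrightarrow> a = 0)" for P
    by blast
  have "\<not> continuous_coboundary \<theta> (iterated_cocycle \<alpha> u n) \<longleftrightarrow>
      (\<forall>a. (\<forall>g. \<theta> g a * iterated_cocycle \<alpha> u n g = a) \<longrightarrow> a = 0)" for n
    unfolding coboundary_iff_solution[OF assms(5-7) unitary_iterated] by (rule solvable)
  then show ?thesis
    unfolding weakly_ergodic_iff[OF assms(5,7)] by (simp only:)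
qed

end
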